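(* Let $k_1\in[0,N]$. A zero-mean Gaussian sequence $[x_k]=(x_0,\dots,x_N)$ of $\mathbb{R}^d$-valued vectors is $CM_L\cap[k_1,N]$-$CM_F$ if and only if there exist $d\times d$ matrices $G_{k,k-1},G_{k,N}$ ($k\in[1,N-1]$), $G_{0,N}$, and a zero-mean white Gaussian sequence $[e_k]=(e_0,\dots,e_N)$ with $G_k=\mathrm{Cov}(e_k)$ such that $$x_k=G_{k,k-1}x_{k-1}+G_{k,N}x_N+e_k,\quad k\in[1,N-1],\qquad x_N=e_N,\quad x_0=G_{0,N}x_N+e_0,$$ and $$P_{k,i}=\begin{bmatrix} P_{k,j} & P_{k,k_1}\end{bmatrix}\begin{bmatrix} P_j & P_{j,k_1}\\ P_{k_1,j} & P_{k_1}\end{bmatrix}^{+}\begin{bmatrix} P_{j,i}\\ P_{k_1,i}\end{bmatrix}$$ for all $i,j,k\in[k_1+1,N]$ with $i<j<k$, where $P=\mathcal{G}^{-1}G(\mathcal{G}')^{-1}$, $G=\mathrm{diag}(G_0,\dots,G_N)$, and $\mathcal{G}$ is the $(N+1)\times(N+1)$ block matrix (blocks indexed by $0,\dots,N$) with $\mathcal{G}_{k,k}=I$ for $k\in[0,N]$, $\mathcal{G}_{k,k-1}=-G_{k,k-1}$ for $k\in[1,N-1]$, $\mathcal{G}_{k,N}=-G_{k,N}$ for $k\in[0,N-1]$, and all other blocks $0$.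
   Context: Sequences are indexed by discrete time $[0,N]=(0,1,\dots,N)$; $[i,j]=(i,\dots,j)$, $[x_k]_i^j=(x_i,\dots,x_j)$; the prime denotes transpose and the superscript $+$ the Moore–Penrose inverse. $P_{i,j}$ is the $d\times d$ block of $P$ in block row $i$, block column $j$ (indexed from $0$), and $P_i=P_{i,i}$. Gaussian sequences are jointly Gaussian, with possibly singular covariance; a white Gaussian sequence is a jointly Gaussian sequence with $e_k,e_j$ uncorrelated for $k\ne j$ (covariances possibly singular). Equations between random vectors hold almost surely. $F(\cdot|\cdot)$ denotes conditional CDF. $[x_k]$ is $CM_L$ iff conditioned on $x_N$ it is Markov over $[0,N-1]$; equivalently $F(\xi_k|[x_i]_0^j,x_N)=F(\xi_k|x_j,x_N)$ (a.s.) for all $j<k$ in $[0,N]$, $\xi_k\in\mathbb{R}^d$. $[x_k]$ is $[k_1,N]$-$CM_F$ iff conditioned on $x_{k_1}$ it is Markov over $[k_1+1,N]$; equivalently $F(\xi_k|[x_i]_{k_1}^j,x_{k_1})=F(\xi_k|x_j,x_{k_1})$ (a.s.) for all $j<k$ in $[k_1,N]$, $\xi_k\in\mathbb{R}^d$. Every sequence is $[k_1,N]$-$CM_F$ when $k_1\in[N-2,N]$. A sequence is $CM_L\cap[k_1,N]$-$CM_F$ iff it is both $CM_L$ and $[k_1,N]$-$CM_F$. *)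

theory Defs
  imports "HOL-Probability.Probability"
begin

section \<open>Matrices\<close>

text \<open>The Moore--Penrose inverse, by the four Penrose conditions (which have exactly one solution
  for every real matrix).\<close>

definition pinv :: "real^'n^'m \<Rightarrow> real^'m^'n" where
  "pinv A = (THE X. A ** X ** A = A \<and> X ** A ** X = X \<and>
               transpose (A ** X) = A ** X \<and> transpose (X ** A) = X ** A)"

definition hblock :: "real^'m^'p \<Rightarrow> real^'n^'p \<Rightarrow> real^('m + 'n)^'p" where
  "hblock A B = (\<chi> r c. case c of Inl j \<Rightarrow> A $ r $ j | Inr j \<Rightarrow> B $ r $ j)"

definition vblock :: "real^'p^'m \<Rightarrow> real^'p^'n \<Rightarrow> real^'p^('m + 'n)" where
  "vblock A B = (\<chi> r. case r of Inl i \<Rightarrow> A $ i | Inr i \<Rightarrow> B $ i)"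

text \<open>An \<open>(N+1) \<times> (N+1)\<close> block matrix with \<open>d \<times> d\<close> blocks is represented by the function giving
  its blocks; only the values at block indices \<open>\<le> N\<close> are meaningful.\<close>

type_synonym 'd bmat = "nat \<Rightarrow> nat \<Rightarrow> real^'d^'d"

definition bmat_mult :: "nat \<Rightarrow> 'd::finite bmat \<Rightarrow> 'd bmat \<Rightarrow> 'd bmat" where
  "bmat_mult N A B = (\<lambda>i j. \<Sum>l\<le>N. A i l ** B l j)"

definition bmat_transpose :: "'d::finite bmat \<Rightarrow> 'd bmat" where
  "bmat_transpose A = (\<lambda>i j. transpose (A j i))"

definition bmat_diag :: "(nat \<Rightarrow> real^'d^'d) \<Rightarrow> 'd::finite bmat" where
  "bmat_diag D = (\<lambda>i j. if i = j then D i else 0)"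

definition bmat_is_one :: "nat \<Rightarrow> 'd::finite bmat \<Rightarrow> bool" where
  "bmat_is_one N A \<longleftrightarrow> (\<forall>i\<le>N. \<forall>j\<le>N. A i j = (if i = j then mat 1 else 0))"

text \<open>Modelled on \<^const>\<open>matrix_inv\<close>; the blocks of the inverse at indices \<open>\<le> N\<close> are determined
  whenever the matrix is invertible.\<close>

definition bmat_inv :: "nat \<Rightarrow> 'd::finite bmat \<Rightarrow> 'd bmat" where
  "bmat_inv N A = (SOME B. bmat_is_one N (bmat_mult N A B) \<and> bmat_is_one N (bmat_mult N B A))"


section \<open>Gaussian sequences\<close>

text \<open>Variance zero is allowed.\<close>

definition gaussian_rv :: "'a measure \<Rightarrow> ('a \<Rightarrow> real) \<Rightarrow> bool" where
  "gaussian_rv M Z \<longleftrightarrow> Z \<in> borel_measurable M \<and>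
     ((\<exists>c. AE \<omega> in M. Z \<omega> = c) \<or>
      (\<exists>\<mu> \<sigma>. \<sigma> > 0 \<and> distributed M lborel Z (normal_density \<mu> \<sigma>)))"

text \<open>Joint Gaussianity: all linear combinations of all components of \<open>x\<^sub>0, \<dots>, x\<^sub>N\<close> are
  (possibly degenerate) normal, so that singular covariances are covered. The values of \<open>x\<close> beyond
  \<open>N\<close> are irrelevant, here and below.\<close>

definition gaussian_seq :: "'a measure \<Rightarrow> nat \<Rightarrow> (nat \<Rightarrow> 'a \<Rightarrow> real^'d) \<Rightarrow> bool" where
  "gaussian_seq M N x \<longleftrightarrow> (\<forall>k\<le>N. x k \<in> borel_measurable M) \<and>
     (\<forall>a :: nat \<Rightarrow> real^'d. gaussian_rv M (\<lambda>\<omega>. \<Sum>k\<le>N. a k \<bullet> x k \<omega>))"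

definition zero_mean_seq :: "'a measure \<Rightarrow> nat \<Rightarrow> (nat \<Rightarrow> 'a \<Rightarrow> real^'d) \<Rightarrow> bool" where
  "zero_mean_seq M N x \<longleftrightarrow> (\<forall>k\<le>N. (\<integral>\<omega>. x k \<omega> \<partial>M) = 0)"

definition cross_cov :: "'a measure \<Rightarrow> ('a \<Rightarrow> real^'m) \<Rightarrow> ('a \<Rightarrow> real^'n) \<Rightarrow> real^'n^'m" where
  "cross_cov M X Y = (\<chi> i j. \<integral>\<omega>. (X \<omega> $ i - (\<integral>\<omega>'. X \<omega>' \<partial>M) $ i) *
                                     (Y \<omega> $ j - (\<integral>\<omega>'. Y \<omega>' \<partial>M) $ j) \<partial>M)"

abbreviation Cov :: "'a measure \<Rightarrow> ('a \<Rightarrow> real^'d) \<Rightarrow> real^'d^'d" where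
  "Cov M X \<equiv> cross_cov M X X"

definition white_gaussian_seq :: "'a measure \<Rightarrow> nat \<Rightarrow> (nat \<Rightarrow> 'a \<Rightarrow> real^'d) \<Rightarrow> bool" where
  "white_gaussian_seq M N e \<longleftrightarrow> gaussian_seq M N e \<and>
     (\<forall>k\<le>N. \<forall>j\<le>N. k \<noteq> j \<longrightarrow> cross_cov M (e k) (e j) = 0)"


section \<open>Conditionally Markov sequences\<close>

definition gen_by :: "'a measure \<Rightarrow> (nat \<Rightarrow> 'a \<Rightarrow> real^'d) \<Rightarrow> nat set \<Rightarrow> 'a measure" where
  "gen_by M x I = sigma (space M) (\<Union>i\<in>I. {x i -` A \<inter> space M | A. A \<in> sets borel})"

text \<open>\<open>F(\<xi> | [x\<^sub>i]\<^sub>i\<^sub>\<in>\<^sub>I)\<close>, the conditional CDF of \<open>X\<close> at \<open>\<xi>\<close>; the order on vectors is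
  componentwise.\<close>

definition cond_CDF ::
  "'a measure \<Rightarrow> ('a \<Rightarrow> real^'d) \<Rightarrow> (nat \<Rightarrow> 'a \<Rightarrow> real^'d) \<Rightarrow> nat set \<Rightarrow> real^'d \<Rightarrow> 'a \<Rightarrow> real" where
  "cond_CDF M X x I \<xi> = real_cond_exp M (gen_by M x I) (indicator {\<omega> \<in> space M. X \<omega> \<le> \<xi>})"

definition CM_L :: "'a measure \<Rightarrow> nat \<Rightarrow> (nat \<Rightarrow> 'a \<Rightarrow> real^'d) \<Rightarrow> bool" where
  "CM_L M N x \<longleftrightarrow> (\<forall>j k \<xi>. j < k \<and> k \<le> N \<longrightarrow>
     (AE \<omega> in M. cond_CDF M (x k) x ({0..j} \<union> {N}) \<xi> \<omega> = cond_CDF M (x k) x {j, N} \<xi> \<omega>))"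

definition CM_F :: "'a measure \<Rightarrow> nat \<Rightarrow> nat \<Rightarrow> (nat \<Rightarrow> 'a \<Rightarrow> real^'d) \<Rightarrow> bool" where
  "CM_F M k1 N x \<longleftrightarrow> (\<forall>j k \<xi>. k1 \<le> j \<and> j < k \<and> k \<le> N \<longrightarrow>
     (AE \<omega> in M. cond_CDF M (x k) x ({k1..j} \<union> {k1}) \<xi> \<omega> = cond_CDF M (x k) x {j, k1} \<xi> \<omega>))"


section \<open>The dynamic model\<close>

text \<open>The coefficients \<open>G\<^sub>k\<^sub>,\<^sub>k\<^sub>-\<^sub>1\<close> and \<open>G\<^sub>k\<^sub>,\<^sub>N\<close> are the values of one doubly indexed family \<open>G\<close>; since
  \<open>G\<^sub>k\<^sub>,\<^sub>k\<^sub>-\<^sub>1\<close> only occurs for \<open>1 \<le> k \<le> N-1\<close>, the two kinds of index pairs never coincide.\<close>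

definition model_bmat :: "nat \<Rightarrow> 'd::finite bmat \<Rightarrow> 'd bmat" where
  "model_bmat N G = (\<lambda>k l.
     if k = l then mat 1
     else if k \<in> {1..N-1} \<and> l = k - 1 then - G k (k - 1)
     else if k < N \<and> l = N then - G k N
     else 0)"

definition model_cov :: "nat \<Rightarrow> 'd::finite bmat \<Rightarrow> (nat \<Rightarrow> real^'d^'d) \<Rightarrow> 'd bmat" where
  "model_cov N G D =
     bmat_mult N (bmat_mult N (bmat_inv N (model_bmat N G)) (bmat_diag D))
                 (bmat_inv N (bmat_transpose (model_bmat N G)))"

end

(* For jointly Gaussian vectors uncorrelated means independent, so the conditional CDF of x_k given
   (x_i)_{i in I} agrees with the one given (x_j)_{j in J}, J a subset of I, exactly when the
   residual of the linear regression of x_k on (x_j)_{j in J} is uncorrelated with all x_i, i in I.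
   Hence both conditional Markov properties are statements about the covariance matrix of x alone.
   The CM_L property says that the residuals e_k of x_k on x_{k-1} and x_N form a white sequence,
   which is the dynamic model; solving it for x shows that the model covariance P is the covariance
   of x. The CM_F property says that the residual of x_k on x_j and x_{k1} is uncorrelated with x_i
   for i < j, which is the block identity by the pseudoinverse form of the regression coefficients.
   That uncorrelated Gaussian vectors are independent is reduced to one-dimensional Levy uniqueness
   by restricting the measure to one coordinate at a time. *)

theory Submission
  imports Defs
begin

section \<open>Moore--Penrose inverses\<close>

text \<open>Covariances may be singular, so neither conditional densities nor inverse covariance
  matrices are at hand. Regression coefficients are therefore taken as some solution of the normal
  equations, and the pseudoinverse enters only afterwards: once the outer factors of the block
  identity have the form \<open>K ** Pi\<close> and \<open>Pi ** L\<close>, the rule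
  \<open>Pi ** pinv Pi ** Pi = Pi\<close> reduces the triple product to \<open>K ** Pi ** L\<close>,
  whatever solutions \<open>K\<close> and \<open>L\<close> were chosen.

  The two directions between CDFs and correlations differ in nature. From zero correlation,
  independence lets the residual be integrated out, and both conditional CDFs become the same
  function of the prediction. Conversely no conditional law is computed: equality of the CDFs is
  integrated against events, which gives the residual conditional mean zero.

  The Markov properties concern arbitrary \<open>j < k\<close>, the model links neighbours only; the
  gap is closed by substituting the model equations into each other. For \<open>N = 0\<close> the
  equations for \<open>x N\<close> and \<open>x 0\<close> concern the same vector, and
  \<open>G 0 0 = 0\<close> reconciles them.\<close>

lemma normal_equations_solvable:
  fixes A :: "real^'n^'m"
  obtains X :: "real^'m^'n" where "transpose A ** A ** X = transpose A"
proof -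
  \<comment> \<open>Split \<open>b\<close> into its projection onto the column space of
    \<open>A\<close> and an orthogonal remainder; \<open>transpose A\<close> annihilates the
    remainder.\<close>
  have "\<exists>x. transpose A *v (A *v x) = transpose A *v b" for b
  proof -
    obtain y z where y: "y \<in> span (range ((*v) A))"
      and z: "\<And>w. w \<in> span (range ((*v) A)) \<Longrightarrow> orthogonal z w" and b: "b = y + z"
      by (metis orthogonal_subspace_decomp_exists)
    have "span (range ((*v) A)) = range ((*v) A)"
    by (rule span_eq_iff[THEN iffD2]) (metis linear_subspace_image matrix_vector_mul_linear subspace_UNIV)
    then obtain x where x: "y = A *v x" using y by (metis imageE)
    have "(transpose A *v z) \<bullet> v = 0" for v
    proof -
      have "(transpose A *v z) \<bullet> v = z \<bullet> (A *v v)"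
        by (simp add: dot_lmul_matrix vector_transpose_matrix)
      then show ?thesis
        using z[of "A *v v"] by (simp add: span_base orthogonal_def)
    qed
    then have "transpose A *v z = 0" using inner_eq_zero_iff by blast
    then show ?thesis using b x by (metis add.right_neutral matrix_vector_right_distrib)
  qed
  then obtain f where f: "\<And>b. transpose A *v (A *v f b) = transpose A *v b" by metis
  \<comment> \<open>The choice function \<open>f\<close> need not be linear. Only its values at the
    basis vectors are used, as the columns of the solution matrix.\<close>
  have "transpose A ** A ** (\<chi> i j. f (axis j 1) $ i) = transpose A"
  proof (intro matrix_eq[THEN iffD2] allI)
    fix v
    have c: "(\<chi> i j. f (axis j 1) $ i) *v v = (\<Sum>j\<in>UNIV. v $ j *\<^sub>R f (axis j 1))"
      by (simp add: vec_eq_iff matrix_vector_mult_def mult.commute)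
    have "transpose A *v (A *v (\<Sum>j\<in>UNIV. v $ j *\<^sub>R f (axis j 1))) = (\<Sum>j\<in>UNIV. v $ j *\<^sub>R (transpose A *v axis j 1))"
      by (simp add: linear_sum[OF matrix_vector_mul_linear] matrix_vector_mult_scaleR f del: transpose_matrix_vector)
    also have "\<dots> = transpose A *v (\<Sum>j\<in>UNIV. v $ j *\<^sub>R axis j 1)"
      by (simp add: linear_sum[OF matrix_vector_mul_linear] matrix_vector_mult_scaleR del: transpose_matrix_vector)
    also have "(\<Sum>j\<in>UNIV. v $ j *\<^sub>R axis j 1) = v"
      by (simp add: vec_eq_iff axis_def if_distrib cong: if_cong)
    finally show "(transpose A ** A ** (\<chi> i j. f (axis j 1) $ i)) *v v = transpose A *v v"
      by (simp add: c del: transpose_matrix_vector flip: matrix_vector_mul_assoc)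
  qed
  then show ?thesis by (rule that)
qed

definition penrose :: "real^'n^'m \<Rightarrow> real^'m^'n \<Rightarrow> bool" where
  "penrose A X \<longleftrightarrow> A ** X ** A = A \<and> X ** A ** X = X \<and>
     transpose (A ** X) = A ** X \<and> transpose (X ** A) = X ** A"

text \<open>The digits count Penrose conditions. Multiplying the normal equations by
  \<open>transpose X\<close> shows that the transpose of \<open>A ** X\<close> is a Gram matrix,
  hence symmetric; transposing the normal equations then gives the first condition.\<close>

lemma inverse_13_exists:
  fixes A :: "real^'n^'m"
  obtains X where "A ** X ** A = A" "transpose (A ** X) = A ** X"
proof -
  obtain X where X: "transpose A ** A ** X = transpose A"
    using normal_equations_solvable by blast
  have sym: "transpose (A ** X) = A ** X"
  proof -
    have "transpose (A ** X) = transpose X ** (transpose A ** A ** X)"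
      by (simp add: X matrix_transpose_mul)
    also have "\<dots> = transpose (transpose X ** (transpose A ** A ** X))"
      by (simp add: matrix_transpose_mul matrix_mul_assoc)
    also have "\<dots> = A ** X"
      by (simp add: X matrix_transpose_mul)
    finally show ?thesis .
  qed
  have "A ** X ** A = transpose (transpose A ** (A ** X))"
    by (simp add: matrix_transpose_mul sym[unfolded matrix_transpose_mul])
  also have "\<dots> = A" by (simp add: matrix_mul_assoc X)
  finally show ?thesis using sym that by blast
qed

text \<open>Transposing such an inverse of \<open>transpose A\<close> gives \<open>Y\<close> with
  the first and fourth conditions. The product \<open>Y ** A ** X\<close> acts like \<open>X\<close>
  after multiplication by \<open>A\<close> from the left and like \<open>Y\<close> after
  multiplication from the right, so it inherits both symmetries.\<close>

lemma penrose_exists: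
  fixes A :: "real^'n^'m"
  obtains X where "penrose A X"
proof -
  obtain X where X: "A ** X ** A = A" "transpose (A ** X) = A ** X"
    using inverse_13_exists by blast
  obtain Z where Z: "transpose A ** Z ** transpose A = transpose A"
      "transpose (transpose A ** Z) = transpose A ** Z"
    using inverse_13_exists by blast
  define Y where "Y = transpose Z"
  have Y: "A ** Y ** A = A"
    using arg_cong[OF Z(1), of transpose] by (simp add: Y_def matrix_transpose_mul matrix_mul_assoc)
  have Y2: "transpose (Y ** A) = Y ** A"
    using Z(2) by (simp add: Y_def matrix_transpose_mul)
  have 1: "A ** (Y ** A ** X) = A ** X"
    by (metis Y matrix_mul_assoc)
  have 2: "(Y ** A ** X) ** A = Y ** A"
    by (metis X(1) matrix_mul_assoc)
  have "penrose A (Y ** A ** X)"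
    unfolding penrose_def 1 2
    using X Y2 by (metis Y matrix_mul_assoc)
  then show ?thesis by (rule that)
qed

text \<open>\<open>A ** X\<close> and \<open>A ** Y\<close> are the same orthogonal projection, and
  so are \<open>X ** A\<close> and \<open>Y ** A\<close>; hence \<open>X = X ** A ** X\<close> can
  be rewritten into \<open>Y ** A ** Y = Y\<close>.\<close>

lemma penrose_unique:
  assumes "penrose A X" "penrose A Y"
  shows "X = Y"
proof -
  have X: "A ** X ** A = A" "X ** A ** X = X" "transpose (A ** X) = A ** X" "transpose (X ** A) = X ** A"
    and Y: "A ** Y ** A = A" "Y ** A ** Y = Y" "transpose (A ** Y) = A ** Y" "transpose (Y ** A) = Y ** A"
    using assms by (auto simp: penrose_def)
  have "A ** X = transpose (A ** Y ** A ** X)" using Y(1) X(3) by simp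
  also have "\<dots> = A ** X ** (A ** Y)"
    by (metis X(3) Y(3) matrix_mul_assoc matrix_transpose_mul)
  also have "\<dots> = A ** Y" by (simp add: matrix_mul_assoc X(1))
  finally have a: "A ** X = A ** Y" .
  have "X ** A = transpose (X ** A ** Y ** A)" using Y(1) X(4) by (metis matrix_mul_assoc)
  also have "\<dots> = Y ** A ** (X ** A)"
    by (metis X(4) Y(4) matrix_mul_assoc matrix_transpose_mul)
  also have "\<dots> = Y ** A" by (metis matrix_mul_assoc X(1))
  finally have b: "X ** A = Y ** A" .
  show ?thesis by (metis X(2) Y(2) a b matrix_mul_assoc)
qed

text \<open>Existence and uniqueness give the \<open>THE\<close> in \<open>pinv\<close> its meaning;
  the first Penrose condition is what the covariance identity draws on.\<close>

lemma mult_pinv_mult: "A ** pinv A ** A = (A :: real^'n^'m)"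
proof -
  have "\<exists>!X. penrose A X"
    by (metis penrose_exists penrose_unique)
  then have "penrose A (THE X. penrose A X)" by (rule theI')
  then show ?thesis by (simp add: pinv_def penrose_def)
qed

section \<open>Arithmetic of block rows and block columns\<close>

lemma hblock_mult_vblock: "hblock A B ** vblock C D = A ** C + B ** D"
  by (simp add: vec_eq_iff matrix_matrix_mult_def hblock_def vblock_def UNIV_Plus_UNIV[symmetric] sum.Plus del: UNIV_Plus_UNIV)

lemma mult_hblock: "A ** hblock B C = hblock (A ** B) (A ** C)"
  by (auto simp: vec_eq_iff matrix_matrix_mult_def hblock_def split: sum.split)

lemma vblock_mult: "vblock A B ** C = vblock (A ** C) (B ** C)"
  by (auto simp: vec_eq_iff matrix_matrix_mult_def vblock_def split: sum.split)

lemma hblock_add: "hblock A B + hblock C D = hblock (A + C) (B + D)"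
  by (auto simp: vec_eq_iff hblock_def split: sum.split)

section \<open>Finite-dimensional characteristic functions\<close>

lemma (in finite_measure) integrable_bounded_mult:
  fixes f g :: "'a \<Rightarrow> complex"
  assumes [measurable]: "f \<in> borel_measurable M" "g \<in> borel_measurable M"
    and "\<And>x. norm (f x) \<le> K" "\<And>x. norm (g x) \<le> L"
  shows "integrable M (\<lambda>x. f x * g x)"
proof (rule integrable_const_bound[where B="K * L"])
  have "norm (f x * g x) \<le> K * L" for x
  proof -
    have "0 \<le> K" using assms(3)[of x] norm_ge_zero[of "f x"] by linarith
    then show ?thesis unfolding norm_mult using assms(3,4) by (intro mult_mono) auto
  qed
  then show "AE x in M. norm (f x * g x) \<le> K * L" by simp
qed simp

lemma (in finite_measure) finite_measure_density_bounded:
  assumes [measurable]: "w \<in> borel_measurable M" and "\<And>x. 0 \<le> w x" "\<And>x. w x \<le> (K::real)"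
  shows "finite_measure (density M w)"
proof
  have "integrable M w"
    by (rule integrable_const_bound[where B=K]) (use assms in auto)
  then have "(\<integral>\<^sup>+x. w x \<partial>M) = ennreal (\<integral>x. w x \<partial>M)"
    using assms by (intro nn_integral_eq_integral) auto
  then show "emeasure (density M w) (space (density M w)) \<noteq> \<infinity>"
    by (simp add: emeasure_density cong: nn_integral_cong)
qed

text \<open>Restricting a measure to an event destroys total mass one, so finite measures have to be
  covered. The common mass is the value of the characteristic function at 0; dividing by it leads
  back to probability measures, with mass zero treated apart.\<close>

lemma Levy_uniqueness_finite:
  fixes M1 M2 :: "real measure"
  assumes "finite_measure M1" "finite_measure M2" and sets1: "sets M1 = sets borel"
    and sets2: "sets M2 = sets borel" and char: "char M1 = char M2"
  shows "M1 = M2"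
proof -
  interpret M1: finite_measure M1 by fact
  interpret M2: finite_measure M2 by fact
  note [measurable_cong] = sets1 sets2
  define c where "c = measure M1 (space M1)"
  have c2: "c = measure M2 (space M2)"
    using fun_cong[OF char, of 0] by (simp add: char_def c_def)
  show ?thesis
  proof (cases "c = 0")
    case True
    then have "emeasure M1 (space M1) = 0" "emeasure M2 (space M2) = 0"
      using c2 by (simp_all add: c_def M1.emeasure_eq_measure M2.emeasure_eq_measure)
    then have "emeasure M1 A = 0" "emeasure M2 A = 0" for A
      by (metis emeasure_space le_zero_eq)+
    then show ?thesis using sets1 sets2 by (intro measure_eqI) auto
  next
    case False
    then have "c > 0" by (simp add: c_def zero_less_measure_iff)
    have prob: "prob_space (scale_measure (ennreal (1/c)) N)"
      if "finite_measure N" "measure N (space N) = c" for N :: "real measure"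
    proof
      interpret finite_measure N by fact
      show "emeasure (scale_measure (ennreal (1/c)) N) (space (scale_measure (ennreal (1/c)) N)) = 1"
        using that \<open>c > 0\<close>
        by (simp add: emeasure_eq_measure space_scale_measure flip: ennreal_mult)
    qed
    have int: "char (scale_measure (ennreal (1/c)) N) t = (1/c) * char N t"
       if "sets N = sets borel" for N t
    proof -
      note [measurable_cong] = that
      have "scale_measure (ennreal (1/c)) N = density N (\<lambda>_. ennreal (1/c))"
        by (rule measure_eqI) (auto simp: emeasure_density nn_integral_cmult_indicator)
      then show ?thesis using \<open>c > 0\<close>
        by (simp add: char_def integral_density scaleR_conv_of_real)
    qed
    have "scale_measure (ennreal (1/c)) M1 = scale_measure (ennreal (1/c)) M2"
      by (rule Levy_uniqueness)
        (use prob[of M1] prob[of M2] assms c2 c_def int in \<open>auto simp: real_distribution_def real_distribution_axioms_def space_scale_measure dest: sets_eq_imp_space_eq\<close>)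
    then have "scale_measure (ennreal c * ennreal (1/c)) M1 = scale_measure (ennreal c * ennreal (1/c)) M2"
      by (metis scale_scale_measure)
    then show ?thesis using \<open>c > 0\<close> by (simp flip: ennreal_mult)
  qed
qed

lemma (in finite_measure) char_distr_density:
  assumes [measurable]: "V \<in> borel_measurable M" "v \<in> borel_measurable M"
    and v: "\<And>x. 0 \<le> v x"
  shows "char (distr (density M v) borel V) u = (CLINT x|M. complex_of_real (v x) * iexp (u * V x))"
  using v by (simp add: char_def integral_distr integral_density scaleR_conv_of_real)

text \<open>A nonnegative weight is a density: the weighted integrals are the characteristic
  functions of the laws of \<open>U\<close> and \<open>U'\<close> under the weighted measures, so
  these laws coincide.\<close>

lemma weighted_char_unique_nonneg:
  fixes U w :: "'a \<Rightarrow> real" and U' w' :: "'b \<Rightarrow> real"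
  assumes "finite_measure M" "finite_measure M'"
    and [measurable]: "U \<in> borel_measurable M" "U' \<in> borel_measurable M'"
       "w \<in> borel_measurable M" "w' \<in> borel_measurable M'"
    and w: "\<And>x. 0 \<le> w x" "\<And>x. w x \<le> K" "\<And>x. 0 \<le> w' x" "\<And>x. w' x \<le> K"
    and char: "\<And>u. (CLINT x|M. complex_of_real (w x) * iexp (u * U x)) = (CLINT x|M'. complex_of_real (w' x) * iexp (u * U' x))"
    and [measurable]: "B \<in> sets borel"
  shows "(LINT x|M. w x * indicator B (U x)) = (LINT x|M'. w' x * indicator B (U' x))"
proof -
  interpret M: finite_measure M by fact
  interpret M': finite_measure M' by fact
  have "distr (density M w) borel U = distr (density M' w') borel U'"
  proof (rule Levy_uniqueness_finite)
    show "finite_measure (distr (density M w) borel U)" "finite_measure (distr (density M' w') borel U')"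
      using w by (auto intro!: finite_measure.finite_measure_distr M.finite_measure_density_bounded M'.finite_measure_density_bounded)
    show "char (distr (density M w) borel U) = char (distr (density M' w') borel U')"
      using w by (intro ext, subst M.char_distr_density, simp_all, subst M'.char_distr_density, simp_all only: char) (use char in simp_all)
  qed auto
  from arg_cong[OF this, of "\<lambda>m. LINT x|m. indicator B x :: real"]
  show ?thesis
    using w by (simp add: integral_distr integral_density del: Bochner_Integration.integral_indicator)
qed

text \<open>Adding 1 makes the weight nonnegative.\<close>

lemma weighted_char_unique:
  fixes U w :: "'a \<Rightarrow> real" and U' w' :: "'b \<Rightarrow> real"
  assumes fin: "finite_measure M" "finite_measure M'"
    and [measurable]: "U \<in> borel_measurable M" "U' \<in> borel_measurable M'"
       "w \<in> borel_measurable M" "w' \<in> borel_measurable M'"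
    and w: "\<And>x. \<bar>w x\<bar> \<le> 1" "\<And>x. \<bar>w' x\<bar> \<le> 1"
    and char: "\<And>u. (CLINT x|M. iexp (u * U x)) = (CLINT x|M'. iexp (u * U' x))"
    and wchar: "\<And>u. (CLINT x|M. complex_of_real (w x) * iexp (u * U x)) = (CLINT x|M'. complex_of_real (w' x) * iexp (u * U' x))"
    and [measurable]: "B \<in> sets borel"
  shows "(LINT x|M. w x * indicator B (U x)) = (LINT x|M'. w' x * indicator B (U' x))"
proof -
  interpret M: finite_measure M by fact
  interpret M': finite_measure M' by fact
  have w1: "0 \<le> w x + 1" "w x + 1 \<le> 2" for x using w(1)[of x] by (auto simp: abs_le_iff)
  have w2: "0 \<le> w' x + 1" "w' x + 1 \<le> 2" for x using w(2)[of x] by (auto simp: abs_le_iff)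
  have i: "integrable M (\<lambda>x. complex_of_real (w x) * iexp (u * U x))" "integrable M (\<lambda>x. 1 * iexp (u * U x))"
     "integrable M' (\<lambda>x. complex_of_real (w' x) * iexp (u * U' x))" "integrable M' (\<lambda>x. 1 * iexp (u * U' x))" for u
    by (rule M.integrable_bounded_mult[where K=1 and L=1] M'.integrable_bounded_mult[where K=1 and L=1]; use w in simp)+
  have "(LINT x|M. (w x + 1) * indicator B (U x)) = (LINT x|M'. (w' x + 1) * indicator B (U' x))"
    by (rule weighted_char_unique_nonneg[OF fin, where K=2])
      (use w1 w2 i char wchar in \<open>auto simp: distrib_right\<close>)
  moreover have "(LINT x|M. 1 * indicator B (U x) :: real) = (LINT x|M'. 1 * indicator B (U' x))"
    by (rule weighted_char_unique_nonneg[OF fin, where K=1]) (use char in auto)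
  moreover have "integrable M (\<lambda>x. w x * indicator B (U x))" "integrable M (\<lambda>x. indicator B (U x) :: real)"
    by (rule M.integrable_const_bound[where B=1]; use w in \<open>auto simp: indicator_def\<close>)+
  moreover have "integrable M' (\<lambda>x. w' x * indicator B (U' x))" "integrable M' (\<lambda>x. indicator B (U' x) :: real)"
    by (rule M'.integrable_const_bound[where B=1]; use w in \<open>auto simp: indicator_def\<close>)+
  ultimately show ?thesis
    by (simp add: distrib_right)
qed

text \<open>A weight has to be real to act as a density, so the remaining coordinates enter through
  a cosine instead of a complex exponential. Euler's formula brings the weighted integral back to
  joint transforms at the frequencies \<open>T\<close> and \<open>- T\<close>.\<close>

lemma (in finite_measure) char_cos_weight:
  assumes [measurable]: "T \<in> borel_measurable M" "Z \<in> borel_measurable M"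
  shows "(CLINT x|M. complex_of_real (cos (T x + c)) * iexp (Z x)) =
     (iexp c * (CLINT x|M. iexp (T x + Z x)) + iexp (- c) * (CLINT x|M. iexp (- T x + Z x))) / 2"
proof -
  have i: "integrable M (\<lambda>x. iexp (T x + Z x))" "integrable M (\<lambda>x. iexp (- T x + Z x))"
    by (rule integrable_const_bound[where B=1]; simp)+
  have e: "complex_of_real (cos (T x + c)) * iexp (Z x) = (iexp c * iexp (T x + Z x) + iexp (- c) * iexp (- T x + Z x)) / 2" for x
    unfolding cos_of_real[symmetric] cos_exp_eq by (simp add: algebra_simps flip: exp_add)
  show ?thesis
    unfolding e integral_divide_zero
      Bochner_Integration.integral_add[OF integrable_mult_right[OF i(1)] integrable_mult_right[OF i(2)]]
      integral_mult_right_zero ..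
qed

text \<open>The phase \<open>c = 0\<close> gives the real parts. The phase
  \<open>c = - pi / 2\<close> turns the cosine into a sine and gives the imaginary parts.\<close>

lemma cos_eq_imp_iexp_integral_eq:
  assumes "finite_measure M" "finite_measure M'"
    and [measurable]: "T \<in> borel_measurable M" "T' \<in> borel_measurable M'" "F \<in> sets M" "F' \<in> sets M'"
   and eq: "\<And>c. (LINT x|M. cos (T x + c) * indicator F x) = (LINT x|M'. cos (T' x + c) * indicator F' x)"
  shows "(CLINT x|M. indicator F x *\<^sub>R iexp (T x)) = (CLINT x|M'. indicator F' x *\<^sub>R iexp (T' x))"
proof -
  interpret M: finite_measure M by fact
  interpret M': finite_measure M' by fact
  have i: "integrable M (\<lambda>x. indicator F x *\<^sub>R iexp (T x))" "integrable M' (\<lambda>x. indicator F' x *\<^sub>R iexp (T' x))"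
    by (rule M.integrable_const_bound[where B=1] M'.integrable_const_bound[where B=1]; simp add: indicator_def)+
  show ?thesis
  proof (rule complex_eqI)
    show "Re (CLINT x|M. indicator F x *\<^sub>R iexp (T x)) = Re (CLINT x|M'. indicator F' x *\<^sub>R iexp (T' x))"
      using eq[of 0] unfolding integral_Re[OF i(1), symmetric] integral_Re[OF i(2), symmetric]
      by (simp add: Re_exp mult.commute)
    show "Im (CLINT x|M. indicator F x *\<^sub>R iexp (T x)) = Im (CLINT x|M'. indicator F' x *\<^sub>R iexp (T' x))"
      using eq[of "- pi / 2"] unfolding integral_Im[OF i(1), symmetric] integral_Im[OF i(2), symmetric]
      by (simp add: Im_exp mult.commute cos_diff)
  qed
qed

text \<open>Induction on the number of coordinates: by \<open>weighted_char_unique\<close> the equality of the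
  characteristic functions survives restricting both measures to \<open>Z s \<in> B s\<close> for one coordinate \<open>s\<close>.\<close>

lemma char_unique_finite_dimensional:
  fixes Z :: "'i \<Rightarrow> 'a \<Rightarrow> real" and Z' :: "'i \<Rightarrow> 'b \<Rightarrow> real"
  assumes "finite S" "finite_measure M" "finite_measure M'"
    and "\<And>s. s \<in> S \<Longrightarrow> Z s \<in> borel_measurable M" "\<And>s. s \<in> S \<Longrightarrow> Z' s \<in> borel_measurable M'"
    and "\<And>s. s \<in> S \<Longrightarrow> B s \<in> sets borel"
    and "\<And>t. (CLINT x|M. iexp (\<Sum>s\<in>S. t s * Z s x)) = (CLINT x|M'. iexp (\<Sum>s\<in>S. t s * Z' s x))"
  shows "measure M {x\<in>space M. \<forall>s\<in>S. Z s x \<in> B s} = measure M' {x\<in>space M'. \<forall>s\<in>S. Z' s x \<in> B s}"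
  using assms
proof (induction S arbitrary: M M' rule: finite_induct)
  case empty
  then interpret M: finite_measure M by simp
  interpret M': finite_measure M' by fact
  show ?case using empty.prems(6)[of "\<lambda>_. 0"] by simp
next
  case (insert s S)
  interpret M: finite_measure M by fact
  interpret M': finite_measure M' by fact
  have [measurable]: "Z s \<in> borel_measurable M" "Z' s \<in> borel_measurable M'" "B s \<in> sets borel"
    and ZS[measurable]: "\<And>i. i \<in> S \<Longrightarrow> Z i \<in> borel_measurable M" "\<And>i. i \<in> S \<Longrightarrow> Z' i \<in> borel_measurable M'"
    and BS[measurable]: "\<And>i. i \<in> S \<Longrightarrow> B i \<in> sets borel"
    using insert.prems by auto
  define F where "F = {x\<in>space M. Z s x \<in> B s}"
  define F' where "F' = {x\<in>space M'. Z' s x \<in> B s}"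
  have [measurable]: "F \<in> sets M" "F' \<in> sets M'" by (auto simp: F_def F'_def)
  have char: "(CLINT x|M. iexp (u * Z s x + (\<Sum>i\<in>S. t i * Z i x))) = (CLINT x|M'. iexp (u * Z' s x + (\<Sum>i\<in>S. t i * Z' i x)))" for u t
  proof -
    have "(\<Sum>i\<in>insert s S. (t(s := u)) i * z i) = u * z s + (\<Sum>i\<in>S. t i * z i)" for z :: "'i \<Rightarrow> real"
      using insert.hyps by (auto intro!: sum.cong)
    then show ?thesis using insert.prems(6)[of "t(s := u)"] by simp
  qed
  have restr: "(CLINT x|M. indicator F x *\<^sub>R iexp (\<Sum>i\<in>S. t i * Z i x)) = (CLINT x|M'. indicator F' x *\<^sub>R iexp (\<Sum>i\<in>S. t i * Z' i x))" for t
  proof (rule cos_eq_imp_iexp_integral_eq)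
    fix c
    have "(LINT x|M. cos ((\<Sum>i\<in>S. t i * Z i x) + c) * indicator (B s) (Z s x)) =
        (LINT x|M'. cos ((\<Sum>i\<in>S. t i * Z' i x) + c) * indicator (B s) (Z' s x))"
    proof (rule weighted_char_unique)
      fix u
      show "(CLINT x|M. iexp (u * Z s x)) = (CLINT x|M'. iexp (u * Z' s x))"
        using char[of u "\<lambda>_. 0"] by simp
      show "(CLINT x|M. complex_of_real (cos ((\<Sum>i\<in>S. t i * Z i x) + c)) * iexp (u * Z s x)) =
          (CLINT x|M'. complex_of_real (cos ((\<Sum>i\<in>S. t i * Z' i x) + c)) * iexp (u * Z' s x))"
        using char[of u t] char[of u "\<lambda>i. - t i"]
        by (subst M.char_cos_weight, simp, simp, subst M'.char_cos_weight, simp, simp) (simp add: sum_negf algebra_simps)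
    qed (use M.finite_measure_axioms M'.finite_measure_axioms in auto)
    then show "(LINT x|M. cos ((\<Sum>i\<in>S. t i * Z i x) + c) * indicator F x) = (LINT x|M'. cos ((\<Sum>i\<in>S. t i * Z' i x) + c) * indicator F' x)"
      by (simp add: F_def F'_def indicator_def cong: Bochner_Integration.integral_cong)
  qed (use M.finite_measure_axioms M'.finite_measure_axioms in auto)
  \<comment> \<open>Writing the restriction as a density keeps the space and the measurable sets, so
    the other coordinates stay measurable and the induction hypothesis applies to these finite
    measures.\<close>
  let ?D = "density M (indicator F)" and ?D' = "density M' (indicator F')"
  have "measure ?D {x\<in>space ?D. \<forall>i\<in>S. Z i x \<in> B i} = measure ?D' {x\<in>space ?D'. \<forall>i\<in>S. Z' i x \<in> B i}"
  proof (rule insert.IH)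
    show "finite_measure ?D" "finite_measure ?D'"
      using M.finite_measure_density_bounded[of "indicator F" 1] M'.finite_measure_density_bounded[of "indicator F'" 1]
      by (simp_all add: ennreal_indicator)
    show "(CLINT x|?D. iexp (\<Sum>i\<in>S. t i * Z i x)) = (CLINT x|?D'. iexp (\<Sum>i\<in>S. t i * Z' i x))" for t
      using restr[of t]
        integral_density[of "\<lambda>x. iexp (\<Sum>i\<in>S. t i * Z i x)" M "indicator F"]
        integral_density[of "\<lambda>x. iexp (\<Sum>i\<in>S. t i * Z' i x)" M' "indicator F'"]
      by (simp add: ennreal_indicator)
  qed (use ZS BS in auto)
  moreover have "measure ?D {x\<in>space ?D. \<forall>i\<in>S. Z i x \<in> B i} = measure M {x\<in>space M. \<forall>i\<in>insert s S. Z i x \<in> B i}"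
  proof -
    have [measurable]: "{x\<in>space M. \<forall>i\<in>S. Z i x \<in> B i} \<in> sets M"
      using insert.hyps ZS BS by measurable
    have "F \<inter> {x\<in>space M. \<forall>i\<in>S. Z i x \<in> B i} = {x\<in>space M. \<forall>i\<in>insert s S. Z i x \<in> B i}"
      by (auto simp: F_def)
    then show ?thesis by (simp add: measure_restricted)
  qed
  moreover have "measure ?D' {x\<in>space ?D'. \<forall>i\<in>S. Z' i x \<in> B i} = measure M' {x\<in>space M'. \<forall>i\<in>insert s S. Z' i x \<in> B i}"
  proof -
    have [measurable]: "{x\<in>space M'. \<forall>i\<in>S. Z' i x \<in> B i} \<in> sets M'"
      using insert.hyps ZS BS by measurable
    have "F' \<inter> {x\<in>space M'. \<forall>i\<in>S. Z' i x \<in> B i} = {x\<in>space M'. \<forall>i\<in>insert s S. Z' i x \<in> B i}"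
      by (auto simp: F'_def)
    then show ?thesis by (simp add: measure_restricted)
  qed
  ultimately show ?case by simp
qed

section \<open>Gaussian families\<close>

lemma (in prob_space) gaussian_rv_square_integrable:
  assumes "gaussian_rv M Z"
  shows "integrable M Z" "integrable M (\<lambda>\<omega>. (Z \<omega>)\<^sup>2)"
proof -
  have [measurable]: "Z \<in> borel_measurable M" using assms by (simp add: gaussian_rv_def)
  have sq: "integrable M (\<lambda>\<omega>. (Z \<omega>)\<^sup>2)"
    using assms unfolding gaussian_rv_def
  proof (elim conjE disjE exE)
    fix c assume "AE \<omega> in M. Z \<omega> = c"
    then have "integrable M (\<lambda>\<omega>. (Z \<omega>)\<^sup>2) \<longleftrightarrow> integrable M (\<lambda>\<omega>. c\<^sup>2)"
      by (intro integrable_cong_AE) auto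
    then show ?thesis by simp
  next
    fix \<mu> \<sigma> :: real assume \<sigma>: "\<sigma> > 0" and D: "distributed M lborel Z (normal_density \<mu> \<sigma>)"
    \<comment> \<open>The square is expanded around the mean: x^2 = (x - m)^2 + 2 m (x - m) + m^2, a
      combination of central moments.\<close>
    have "integrable lborel (\<lambda>x. normal_density \<mu> \<sigma> x * (x - \<mu>)\<^sup>2 + 2 * \<mu> * (normal_density \<mu> \<sigma> x * (x - \<mu>)^1) + \<mu>\<^sup>2 * (normal_density \<mu> \<sigma> x * (x - \<mu>)^0))"
      by (intro Bochner_Integration.integrable_add integrable_mult_right integrable_normal_moment \<sigma>)
    also have "(\<lambda>x. normal_density \<mu> \<sigma> x * (x - \<mu>)\<^sup>2 + 2 * \<mu> * (normal_density \<mu> \<sigma> x * (x - \<mu>)^1) + \<mu>\<^sup>2 * (normal_density \<mu> \<sigma> x * (x - \<mu>)^0)) = (\<lambda>x. normal_density \<mu> \<sigma> x * x\<^sup>2)"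
      by (simp add: fun_eq_iff algebra_simps power2_eq_square)
    finally show ?thesis
      using distributed_integrable[OF D, of "\<lambda>x. x\<^sup>2"] by simp
  qed
  then show "integrable M (\<lambda>\<omega>. (Z \<omega>)\<^sup>2)" .
  show "integrable M Z" by (rule square_integrable_imp_integrable[OF _ sq]) simp
qed

text \<open>An almost surely constant \<open>Z\<close> with mean zero is zero and fits the formula
  with variance 0. Otherwise \<open>Z\<close> divided by its standard deviation is standard normal,
  and its characteristic function is evaluated at that standard deviation.\<close>

lemma (in prob_space) gaussian_rv_char:
  assumes Z: "gaussian_rv M Z" and mean: "expectation Z = 0"
  shows "(CLINT \<omega>|M. iexp (Z \<omega>)) = exp (- expectation (\<lambda>\<omega>. (Z \<omega>)\<^sup>2) / 2)"
proof -
  have [measurable]: "Z \<in> borel_measurable M" using assms by (simp add: gaussian_rv_def)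
  show ?thesis
    using Z unfolding gaussian_rv_def
  proof (elim conjE disjE exE)
    fix c assume ae: "AE \<omega> in M. Z \<omega> = c"
    have "expectation Z = expectation (\<lambda>_. c)"
      using ae by (intro integral_cong_AE) auto
    then have "c = 0" using mean by (simp add: prob_space)
    have "(CLINT \<omega>|M. iexp (Z \<omega>)) = (CLINT \<omega>|M. 1)"
      using ae \<open>c = 0\<close> by (intro integral_cong_AE) auto
    moreover have "expectation (\<lambda>\<omega>. (Z \<omega>)\<^sup>2) = expectation (\<lambda>_. 0)"
      using ae \<open>c = 0\<close> by (intro integral_cong_AE) auto
    ultimately show ?thesis by (simp add: prob_space)
  next
    fix \<mu> \<sigma> :: real assume \<sigma>: "\<sigma> > 0" and D: "distributed M lborel Z (normal_density \<mu> \<sigma>)"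
    have "\<mu> = 0" using normal_distributed_expectation[OF \<sigma> D] mean by simp
    have var: "expectation (\<lambda>\<omega>. (Z \<omega>)\<^sup>2) = \<sigma>\<^sup>2"
      using normal_distributed_variance[OF \<sigma> D] mean by simp
    define W where "W = (\<lambda>\<omega>. Z \<omega> / \<sigma>)"
    have [measurable]: "W \<in> borel_measurable M" by (simp add: W_def)
    have "distributed M lborel W std_normal_density"
      using D normal_standard_normal_convert[OF \<sigma>, of Z \<mu>] \<open>\<mu> = 0\<close> by (simp add: W_def)
    then have "distr M lborel W = std_normal_distribution"
      by (simp add: distributed_def)
    then have "distr M borel W = std_normal_distribution"
      by (metis distr_cong sets_lborel)
    then have "char (distr M borel W) \<sigma> = exp (- \<sigma>\<^sup>2 / 2)"
      by (simp add: char_std_normal_distribution)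
    then show ?thesis
      using \<sigma> var by (simp add: char_def integral_distr W_def)
  qed
qed

lemma ball_Plus: "(\<forall>s\<in>S <+> T. P s) \<longleftrightarrow> (\<forall>i\<in>S. P (Inl i)) \<and> (\<forall>j\<in>T. P (Inr j))"
  by auto

text \<open>The comparison is with an independent copy: on the product of \<open>M\<close> with
  itself, \<open>U\<close> reads the first coordinate and \<open>V\<close> the second. Fubini makes
  the transform of this family a product, so it agrees with that of the original family, and
  uniqueness carries the product formula for boxes back to \<open>M\<close>.\<close>

lemma (in prob_space) char_factor_imp_indep:
  fixes U :: "'i \<Rightarrow> 'a \<Rightarrow> real" and V :: "'j \<Rightarrow> 'a \<Rightarrow> real"
  assumes fin: "finite S" "finite T"
    and U[measurable]: "\<And>i. i \<in> S \<Longrightarrow> U i \<in> borel_measurable M"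
    and V[measurable]: "\<And>j. j \<in> T \<Longrightarrow> V j \<in> borel_measurable M"
    and B[measurable]: "\<And>i. i \<in> S \<Longrightarrow> B i \<in> sets borel" and C[measurable]: "\<And>j. j \<in> T \<Longrightarrow> C j \<in> sets borel"
    and char: "\<And>s t. (CLINT \<omega>|M. iexp ((\<Sum>i\<in>S. s i * U i \<omega>) + (\<Sum>j\<in>T. t j * V j \<omega>))) =
       (CLINT \<omega>|M. iexp (\<Sum>i\<in>S. s i * U i \<omega>)) * (CLINT \<omega>|M. iexp (\<Sum>j\<in>T. t j * V j \<omega>))"
  shows "prob ({\<omega>\<in>space M. \<forall>i\<in>S. U i \<omega> \<in> B i} \<inter> {\<omega>\<in>space M. \<forall>j\<in>T. V j \<omega> \<in> C j}) =
     prob {\<omega>\<in>space M. \<forall>i\<in>S. U i \<omega> \<in> B i} * prob {\<omega>\<in>space M. \<forall>j\<in>T. V j \<omega> \<in> C j}"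
proof -
  interpret P: pair_prob_space M M ..
  define Z :: "'i + 'j \<Rightarrow> 'a \<Rightarrow> real" where "Z = case_sum U V"
  define Z' :: "'i + 'j \<Rightarrow> 'a \<times> 'a \<Rightarrow> real" where "Z' s p = case_sum (\<lambda>i. U i (fst p)) (\<lambda>j. V j (snd p)) s" for s p
  define E where "E = case_sum B C"
  have m: "measure M {\<omega>\<in>space M. \<forall>s\<in>S <+> T. Z s \<omega> \<in> E s} = measure (M \<Otimes>\<^sub>M M) {p\<in>space (M \<Otimes>\<^sub>M M). \<forall>s\<in>S <+> T. Z' s p \<in> E s}"
  proof (rule char_unique_finite_dimensional)
    fix t :: "'i + 'j \<Rightarrow> real"
    define f where "f \<omega> = (\<Sum>i\<in>S. t (Inl i) * U i \<omega>)" for \<omega>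
    define g where "g \<omega> = (\<Sum>j\<in>T. t (Inr j) * V j \<omega>)" for \<omega>
    have [measurable]: "f \<in> borel_measurable M" "g \<in> borel_measurable M"
      unfolding f_def g_def by measurable
    have "integrable (M \<Otimes>\<^sub>M M) (\<lambda>p. iexp (f (fst p)) * iexp (g (snd p)))"
      by (rule P.integrable_const_bound[where B=1]) (auto simp: norm_mult)
    from P.integral_fst'[OF this]
    have "(CLINT p|M \<Otimes>\<^sub>M M. iexp (f (fst p) + g (snd p))) = (CLINT \<omega>|M. iexp (f \<omega>)) * (CLINT \<omega>|M. iexp (g \<omega>))"
      by (simp add: distrib_left exp_add)
    also have "\<dots> = (CLINT \<omega>|M. iexp (f \<omega> + g \<omega>))"
      using char[of "t \<circ> Inl" "t \<circ> Inr"] by (simp add: f_def g_def)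
    finally show "(CLINT \<omega>|M. iexp (\<Sum>s\<in>S <+> T. t s * Z s \<omega>)) = (CLINT p|M \<Otimes>\<^sub>M M. iexp (\<Sum>s\<in>S <+> T. t s * Z' s p))"
      by (simp add: sum.Plus[OF fin] Z_def Z'_def f_def g_def del: of_real_add of_real_sum)
  qed (use fin U V B C in \<open>auto simp: Z_def Z'_def E_def P.finite_measure_axioms finite_measure_axioms\<close>)
  have [measurable]: "{\<omega>\<in>space M. \<forall>i\<in>S. U i \<omega> \<in> B i} \<in> sets M" "{\<omega>\<in>space M. \<forall>j\<in>T. V j \<omega> \<in> C j} \<in> sets M"
    using fin U V B C by measurable
  have "{p\<in>space (M \<Otimes>\<^sub>M M). \<forall>s\<in>S <+> T. Z' s p \<in> E s} = {\<omega>\<in>space M. \<forall>i\<in>S. U i \<omega> \<in> B i} \<times> {\<omega>\<in>space M. \<forall>j\<in>T. V j \<omega> \<in> C j}"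
    by (auto simp: Z'_def E_def space_pair_measure ball_Plus)
  moreover have "{\<omega>\<in>space M. \<forall>s\<in>S <+> T. Z s \<omega> \<in> E s} = {\<omega>\<in>space M. \<forall>i\<in>S. U i \<omega> \<in> B i} \<inter> {\<omega>\<in>space M. \<forall>j\<in>T. V j \<omega> \<in> C j}"
    by (auto simp: Z_def E_def ball_Plus)
  ultimately show ?thesis
    using m by (simp add: measure_def emeasure_pair_measure_Times enn2real_mult)
qed

section \<open>The linear span of a centred Gaussian sequence\<close>

lemma integrable_vecI:
  fixes f :: "'a \<Rightarrow> real^'d"
  assumes "\<And>b. integrable M (\<lambda>\<omega>. f \<omega> $ b)"
  shows "integrable M f"
proof -
  have "integrable M (\<lambda>\<omega>. \<Sum>b\<in>UNIV. f \<omega> $ b *\<^sub>R (axis b 1 :: real^'d))" using assms by auto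
  also have "(\<lambda>\<omega>. \<Sum>b\<in>UNIV. f \<omega> $ b *\<^sub>R (axis b 1 :: real^'d)) = f"
    by (simp add: fun_eq_iff vec_eq_iff axis_def if_distrib cong: if_cong)
  finally show ?thesis .
qed

locale gaussian_family = prob_space M for M :: "'a measure" +
  fixes N :: nat and x :: "nat \<Rightarrow> 'a \<Rightarrow> real^'d"
  assumes gaussian: "gaussian_seq M N x" and zero_mean: "zero_mean_seq M N x"
begin

text \<open>The Gaussian space of the sequence, as actual functions and not as classes modulo null
  sets. Constants are not adjoined, so every element is centred and the covariance of two elements
  is the expectation of their product.\<close>

definition gspan :: "('a \<Rightarrow> real) set" where
  "gspan = range (\<lambda>(a :: nat \<Rightarrow> real^'d) \<omega>. \<Sum>k\<le>N. a k \<bullet> x k \<omega>)"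

lemma gspan_add: "f \<in> gspan \<Longrightarrow> g \<in> gspan \<Longrightarrow> (\<lambda>\<omega>. f \<omega> + g \<omega>) \<in> gspan"
proof (unfold gspan_def, elim rangeE)
  fix a b :: "nat \<Rightarrow> real^'d"
  assume "f = (\<lambda>\<omega>. \<Sum>k\<le>N. a k \<bullet> x k \<omega>)" "g = (\<lambda>\<omega>. \<Sum>k\<le>N. b k \<bullet> x k \<omega>)"
  then have "(\<lambda>\<omega>. f \<omega> + g \<omega>) = (\<lambda>\<omega>. \<Sum>k\<le>N. (a k + b k) \<bullet> x k \<omega>)"
    by (simp add: inner_add_left sum.distrib)
  then show "(\<lambda>\<omega>. f \<omega> + g \<omega>) \<in> range (\<lambda>(a :: nat \<Rightarrow> real^'d) \<omega>. \<Sum>k\<le>N. a k \<bullet> x k \<omega>)"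
    by (rule image_eqI[where x="\<lambda>k. a k + b k"]) simp
qed

lemma gspan_scale: "f \<in> gspan \<Longrightarrow> (\<lambda>\<omega>. c * f \<omega>) \<in> gspan"
proof (unfold gspan_def, elim rangeE)
  fix a :: "nat \<Rightarrow> real^'d"
  assume "f = (\<lambda>\<omega>. \<Sum>k\<le>N. a k \<bullet> x k \<omega>)"
  then have "(\<lambda>\<omega>. c * f \<omega>) = (\<lambda>\<omega>. \<Sum>k\<le>N. (c *\<^sub>R a k) \<bullet> x k \<omega>)"
    by (simp add: sum_distrib_left)
  then show "(\<lambda>\<omega>. c * f \<omega>) \<in> range (\<lambda>(a :: nat \<Rightarrow> real^'d) \<omega>. \<Sum>k\<le>N. a k \<bullet> x k \<omega>)"
    by (rule image_eqI[where x="\<lambda>k. c *\<^sub>R a k"]) simp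
qed

lemma gspan_diff: "f \<in> gspan \<Longrightarrow> g \<in> gspan \<Longrightarrow> (\<lambda>\<omega>. f \<omega> - g \<omega>) \<in> gspan"
  using gspan_add[of f "\<lambda>\<omega>. - 1 * g \<omega>"] gspan_scale[of g "-1"] by simp

lemma gspan_zero: "(\<lambda>_. 0) \<in> gspan"
  unfolding gspan_def by (rule image_eqI[of _ _ "\<lambda>_. 0"]) auto

lemma gspan_sum: "(\<And>i. i \<in> S \<Longrightarrow> f i \<in> gspan) \<Longrightarrow> (\<lambda>\<omega>. \<Sum>i\<in>S. f i \<omega>) \<in> gspan"
  by (induction S rule: infinite_finite_induct) (auto simp: gspan_zero gspan_add)

lemma gspan_component: "k \<le> N \<Longrightarrow> (\<lambda>\<omega>. x k \<omega> $ b) \<in> gspan"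
  unfolding gspan_def
  by (rule image_eqI[of _ _ "\<lambda>i. if i = k then axis b 1 else 0"])
    (auto simp: fun_eq_iff inner_axis' if_distrib[of "\<lambda>v. v \<bullet> _"] cong: if_cong)

lemma measurable_x [measurable]: "k \<le> N \<Longrightarrow> x k \<in> borel_measurable M"
  using gaussian by (simp add: gaussian_seq_def)

lemma gspan_gaussian: "f \<in> gspan \<Longrightarrow> gaussian_rv M f"
  using gaussian by (auto simp: gspan_def gaussian_seq_def)

lemma gspan_measurable [measurable_dest]: "f \<in> gspan \<Longrightarrow> f \<in> borel_measurable M"
  using gspan_gaussian by (auto simp: gaussian_rv_def)

lemma integrable_x: "k \<le> N \<Longrightarrow> integrable M (x k)"
  by (intro integrable_vecI gaussian_rv_square_integrable(1) gspan_gaussian gspan_component)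

lemma gspan_mean: "f \<in> gspan \<Longrightarrow> expectation f = 0"
proof (unfold gspan_def, elim rangeE)
  fix a :: "nat \<Rightarrow> real^'d" assume f: "f = (\<lambda>\<omega>. \<Sum>k\<le>N. a k \<bullet> x k \<omega>)"
  have "expectation f = (\<Sum>k\<le>N. a k \<bullet> (\<integral>\<omega>. x k \<omega> \<partial>M))"
    unfolding f using integrable_x by (simp add: integral_inner_left integrable_inner_left)
  then show ?thesis using zero_mean by (simp add: zero_mean_seq_def)
qed

lemma gspan_integrable: "f \<in> gspan \<Longrightarrow> integrable M f"
  by (rule gaussian_rv_square_integrable[OF gspan_gaussian])

text \<open>Polarisation: sum and difference of two elements are again Gaussian, hence square
  integrable.\<close>

lemma gspan_integrable_mult: "f \<in> gspan \<Longrightarrow> g \<in> gspan \<Longrightarrow> integrable M (\<lambda>\<omega>. f \<omega> * g \<omega>)"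
proof -
  assume f: "f \<in> gspan" and g: "g \<in> gspan"
  have "integrable M (\<lambda>\<omega>. ((f \<omega> + g \<omega>)\<^sup>2 - (f \<omega> - g \<omega>)\<^sup>2) / 4)"
    using gspan_add[OF f g] gspan_diff[OF f g]
    by (intro integrable_divide Bochner_Integration.integrable_diff gaussian_rv_square_integrable(2) gspan_gaussian)
  moreover have "(\<lambda>\<omega>. ((f \<omega> + g \<omega>)\<^sup>2 - (f \<omega> - g \<omega>)\<^sup>2) / 4) = (\<lambda>\<omega>. f \<omega> * g \<omega>)"
    by (simp add: fun_eq_iff power2_eq_square algebra_simps)
  ultimately show ?thesis by simp
qed

lemma gspan_char: "f \<in> gspan \<Longrightarrow> (CLINT \<omega>|M. iexp (f \<omega>)) = exp (- expectation (\<lambda>\<omega>. (f \<omega>)\<^sup>2) / 2)"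
  by (rule gaussian_rv_char[OF gspan_gaussian gspan_mean])

text \<open>The characteristic function of a centred Gaussian depends on its variance alone, and
  variances of uncorrelated elements add. Degenerate elements are included.\<close>

lemma gspan_char_factor:
  assumes f: "f \<in> gspan" and g: "g \<in> gspan" and "expectation (\<lambda>\<omega>. f \<omega> * g \<omega>) = 0"
  shows "(CLINT \<omega>|M. iexp (f \<omega> + g \<omega>)) = (CLINT \<omega>|M. iexp (f \<omega>)) * (CLINT \<omega>|M. iexp (g \<omega>))"
proof -
  have "expectation (\<lambda>\<omega>. (f \<omega> + g \<omega>)\<^sup>2) = expectation (\<lambda>\<omega>. f \<omega> * f \<omega> + g \<omega> * g \<omega> + 2 * (f \<omega> * g \<omega>))"
    by (simp add: power2_eq_square algebra_simps)
  also have "\<dots> = expectation (\<lambda>\<omega>. (f \<omega>)\<^sup>2) + expectation (\<lambda>\<omega>. (g \<omega>)\<^sup>2)"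
    using assms gspan_integrable_mult[OF f f] gspan_integrable_mult[OF g g] gspan_integrable_mult[OF f g]
    by (simp add: power2_eq_square)
  finally show ?thesis
    using gspan_char[OF gspan_add[OF f g]] gspan_char[OF f] gspan_char[OF g]
    by (simp add: add_divide_distrib diff_divide_distrib flip: exp_add of_real_mult of_real_add)
qed

lemma gspan_uncorrelated_indep:
  assumes fin: "finite S" "finite T"
    and U: "\<And>i. i \<in> S \<Longrightarrow> U i \<in> gspan" and V: "\<And>j. j \<in> T \<Longrightarrow> V j \<in> gspan"
    and B: "\<And>i. i \<in> S \<Longrightarrow> B i \<in> sets borel" and C: "\<And>j. j \<in> T \<Longrightarrow> C j \<in> sets borel"
    and unc: "\<And>i j. i \<in> S \<Longrightarrow> j \<in> T \<Longrightarrow> expectation (\<lambda>\<omega>. U i \<omega> * V j \<omega>) = 0"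
  shows "prob ({\<omega>\<in>space M. \<forall>i\<in>S. U i \<omega> \<in> B i} \<inter> {\<omega>\<in>space M. \<forall>j\<in>T. V j \<omega> \<in> C j}) =
     prob {\<omega>\<in>space M. \<forall>i\<in>S. U i \<omega> \<in> B i} * prob {\<omega>\<in>space M. \<forall>j\<in>T. V j \<omega> \<in> C j}"
proof (rule char_factor_imp_indep[OF fin])
  fix s t
  show "(CLINT \<omega>|M. iexp ((\<Sum>i\<in>S. s i * U i \<omega>) + (\<Sum>j\<in>T. t j * V j \<omega>))) =
       (CLINT \<omega>|M. iexp (\<Sum>i\<in>S. s i * U i \<omega>)) * (CLINT \<omega>|M. iexp (\<Sum>j\<in>T. t j * V j \<omega>))"
  proof (rule gspan_char_factor)
    have "expectation (\<lambda>\<omega>. (\<Sum>i\<in>S. s i * U i \<omega>) * (\<Sum>j\<in>T. t j * V j \<omega>)) =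
        expectation (\<lambda>\<omega>. \<Sum>i\<in>S. \<Sum>j\<in>T. s i * t j * (U i \<omega> * V j \<omega>))"
      by (simp add: sum_product ac_simps)
    also have "\<dots> = (\<Sum>i\<in>S. \<Sum>j\<in>T. s i * t j * expectation (\<lambda>\<omega>. U i \<omega> * V j \<omega>))"
      using gspan_integrable_mult[OF U V] by simp
    finally show "expectation (\<lambda>\<omega>. (\<Sum>i\<in>S. s i * U i \<omega>) * (\<Sum>j\<in>T. t j * V j \<omega>)) = 0"
      using unc by simp
  qed (use U V in \<open>auto intro!: gspan_sum gspan_scale\<close>)
qed (use U V B C gspan_measurable in auto)

end

section \<open>Conditional distribution functions\<close>

lemma space_sets_gen_by:
  "space (gen_by M x I) = space M"
  "sets (gen_by M x I) = sigma_sets (space M) (\<Union>i\<in>I. {x i -` A \<inter> space M | A. A \<in> sets borel})"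
  unfolding gen_by_def by (subst space_measure_of sets_measure_of; auto)+

lemma measurable_gen_by: "i \<in> I \<Longrightarrow> x i \<in> borel_measurable (gen_by M x I)"
  by (rule measurableI) (auto simp: space_sets_gen_by intro!: sigma_sets.Basic)

lemma gen_by_le:
  assumes "space F = space M" "\<And>i. i \<in> I \<Longrightarrow> x i \<in> borel_measurable F"
  shows "sets (gen_by M x I) \<subseteq> sets F"
proof -
  have "sigma_sets (space F) (\<Union>i\<in>I. {x i -` A \<inter> space F | A. A \<in> sets borel}) \<subseteq> sets F"
    using assms(2) by (intro sets.sigma_sets_subset) (auto dest: measurable_sets)
  then show ?thesis by (simp only: space_sets_gen_by(2) assms(1))
qed

lemma subalgebra_gen_by:
  assumes "\<And>i. i \<in> I \<Longrightarrow> x i \<in> borel_measurable M"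
  shows "subalgebra M (gen_by M x I)"
  using gen_by_le[OF refl assms] by (simp add: subalgebra_def space_sets_gen_by(1))

lemma borel_measurable_vec_iff:
  fixes f :: "'a \<Rightarrow> real^'d"
  shows "f \<in> borel_measurable M \<longleftrightarrow> (\<forall>b. (\<lambda>\<omega>. f \<omega> $ b) \<in> borel_measurable M)"
  unfolding borel_measurable_euclidean_space[of f] by (auto simp: Basis_vec_def inner_axis)

text \<open>Product events serve as an intersection-stable generator on which independence can be
  tested. A factor may be \<open>UNIV\<close>, so conditions on a single coordinate are boxes as
  well.\<close>

definition boxes :: "'a set \<Rightarrow> 'i set \<Rightarrow> ('i \<Rightarrow> 'a \<Rightarrow> real) \<Rightarrow> 'a set set" where
  "boxes \<Omega> S U = (\<lambda>B. {\<omega>\<in>\<Omega>. \<forall>i\<in>S. U i \<omega> \<in> B i}) ` {B. \<forall>i\<in>S. B i \<in> sets borel}"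

lemma Int_stable_boxes: "Int_stable (boxes \<Omega> S U)"
  unfolding boxes_def
proof (rule Int_stableI_image)
  fix B C :: "'b \<Rightarrow> real set"
  assume "B \<in> {B. \<forall>i\<in>S. B i \<in> sets borel}" "C \<in> {B. \<forall>i\<in>S. B i \<in> sets borel}"
  then show "\<exists>D\<in>{B. \<forall>i\<in>S. B i \<in> sets borel}. {\<omega>\<in>\<Omega>. \<forall>i\<in>S. U i \<omega> \<in> B i} \<inter> {\<omega>\<in>\<Omega>. \<forall>i\<in>S. U i \<omega> \<in> C i} = {\<omega>\<in>\<Omega>. \<forall>i\<in>S. U i \<omega> \<in> D i}"
    by (intro bexI[of _ "\<lambda>i. B i \<inter> C i"]) auto
qed

lemma measurable_sigma_boxes: "i \<in> S \<Longrightarrow> U i \<in> borel_measurable (sigma \<Omega> (boxes \<Omega> S U))"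
proof (rule measurableI)
  fix A :: "real set" assume i: "i \<in> S" and A: "A \<in> sets borel"
  have s: "boxes \<Omega> S U \<subseteq> Pow \<Omega>" by (auto simp: boxes_def)
  have "U i -` A \<inter> \<Omega> \<in> boxes \<Omega> S U"
    unfolding boxes_def using i A
    by (intro image_eqI[of _ _ "\<lambda>j. if j = i then A else UNIV"]) auto
  then show "U i -` A \<inter> space (sigma \<Omega> (boxes \<Omega> S U)) \<in> sets (sigma \<Omega> (boxes \<Omega> S U))"
    using s by (simp add: space_measure_of sets_measure_of sigma_sets.Basic)
qed simp

context gaussian_family
begin

text \<open>The product formula is known on boxes in the components and extends to the generated
  sigma-algebras because boxes are intersection stable. Measurability of a vector is componentwise,
  so these sigma-algebras contain the ones generated by \<open>r\<close> and by the
  \<open>x i\<close>.\<close>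

lemma uncorrelated_imp_indep_set:
  fixes r :: "'a \<Rightarrow> real^'e"
  assumes r: "\<And>a. (\<lambda>\<omega>. r \<omega> $ a) \<in> gspan" and I: "I \<subseteq> {..N}"
    and unc: "\<And>i a b. i \<in> I \<Longrightarrow> expectation (\<lambda>\<omega>. r \<omega> $ a * x i \<omega> $ b) = 0"
  shows "indep_set (sigma_sets (space M) {r -` A \<inter> space M |A. A \<in> sets borel}) (sets (gen_by M x I))"
proof -
  define U where "U = (\<lambda>a \<omega>. r \<omega> $ a)"
  define V where "V = (\<lambda>p \<omega>. x (fst p) \<omega> $ snd p)"
  let ?S = "UNIV :: 'e set" and ?T = "I \<times> (UNIV :: 'd set)"
  have fin: "finite ?T" using I by (simp add: finite_subset)
  have U: "U a \<in> gspan" for a using r by (simp add: U_def)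
  have V: "p \<in> ?T \<Longrightarrow> V p \<in> gspan" for p
    using gspan_component[of "fst p" "snd p"] I by (auto simp: V_def)
  have [measurable]: "U a \<in> borel_measurable M" "p \<in> ?T \<Longrightarrow> V p \<in> borel_measurable M" for a p
    using U V gspan_measurable by auto
  have "indep_set (boxes (space M) ?S U) (boxes (space M) ?T V)"
  proof (rule indep_setI)
    show "boxes (space M) ?S U \<subseteq> events"
    proof (unfold boxes_def, clarify)
      fix B :: "'e \<Rightarrow> real set" assume [measurable]: "\<forall>i\<in>UNIV. B i \<in> sets borel"
      show "{\<omega> \<in> space M. \<forall>i\<in>UNIV. U i \<omega> \<in> B i} \<in> events" by measurable
    qed
    show "boxes (space M) ?T V \<subseteq> events"
    proof (unfold boxes_def, clarify)
      fix B :: "nat \<times> 'd \<Rightarrow> real set" assume [measurable]: "\<forall>i\<in>?T. B i \<in> sets borel"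
      show "{\<omega> \<in> space M. \<forall>i\<in>?T. V i \<omega> \<in> B i} \<in> events" using fin by measurable
    qed
    show "prob (a \<inter> b) = prob a * prob b" if ab: "a \<in> boxes (space M) ?S U" "b \<in> boxes (space M) ?T V" for a b
    proof -
      obtain B where B: "a = {\<omega>\<in>space M. \<forall>i\<in>?S. U i \<omega> \<in> B i}" "B \<in> {B. \<forall>i\<in>?S. B i \<in> sets borel}"
        using ab(1) unfolding boxes_def by (rule imageE)
      obtain C where C: "b = {\<omega>\<in>space M. \<forall>j\<in>?T. V j \<omega> \<in> C j}" "C \<in> {B. \<forall>j\<in>?T. B j \<in> sets borel}"
        using ab(2) unfolding boxes_def by (rule imageE)
      show ?thesis
        unfolding B(1) C(1)
      proof (rule gspan_uncorrelated_indep)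
        show "U i \<in> gspan" for i by (rule U)
        show "V j \<in> gspan" if "j \<in> ?T" for j using that by (rule V)
        show "B i \<in> sets borel" for i using B(2) by simp
        show "C j \<in> sets borel" if "j \<in> ?T" for j using C(2) that by blast
        show "expectation (\<lambda>\<omega>. U i \<omega> * V j \<omega>) = 0" if "j \<in> ?T" for i j
          using that unc by (cases j) (simp add: U_def V_def)
      qed (use fin in simp_all)
    qed
  qed
  then have ind: "indep_set (sigma_sets (space M) (boxes (space M) ?S U)) (sigma_sets (space M) (boxes (space M) ?T V))"
    by (rule indep_set_sigma_sets) (rule Int_stable_boxes)+
  have pow: "boxes (space M) ?S U \<subseteq> Pow (space M)" "boxes (space M) ?T V \<subseteq> Pow (space M)"
    by (auto simp: boxes_def)
  have r_sigma: "r \<in> borel_measurable (sigma (space M) (boxes (space M) ?S U))"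
    using measurable_sigma_boxes[of _ ?S U "space M"]
    by (subst borel_measurable_vec_iff) (auto simp: U_def)
  have "x i \<in> borel_measurable (sigma (space M) (boxes (space M) ?T V))" if "i \<in> I" for i
    using measurable_sigma_boxes[of "(i, _)" ?T V "space M"] that
    by (subst borel_measurable_vec_iff) (auto simp: V_def)
  then have gen: "sets (gen_by M x I) \<subseteq> sets (sigma (space M) (boxes (space M) ?T V))"
    using pow by (intro gen_by_le) (auto simp: space_measure_of)
  have sub: "sigma_sets (space M) {r -` A \<inter> space M |A. A \<in> sets borel} \<subseteq> sigma_sets (space M) (boxes (space M) ?S U)"
    using measurable_sets[OF r_sigma] pow
    by (intro sigma_sets_mono) (auto simp: space_measure_of sets_measure_of)
  show ?thesis
  proof (rule indep_setI)
    show "sigma_sets (space M) {r -` A \<inter> space M |A. A \<in> sets borel} \<subseteq> events" "sets (gen_by M x I) \<subseteq> events"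
      using sub gen pow indep_setD_ev1[OF ind] indep_setD_ev2[OF ind] by (auto simp: sets_measure_of)
    show "prob (a \<inter> b) = prob a * prob b"
      if "a \<in> sigma_sets (space M) {r -` A \<inter> space M |A. A \<in> sets borel}" "b \<in> sets (gen_by M x I)" for a b
      using that sub gen pow by (intro indep_setD[OF ind]) (auto simp: sets_measure_of)
  qed
qed

end

text \<open>Freezing: since \<open>r\<close> is independent of \<open>F\<close>, the pair of
  \<open>r\<close> and a point seen through \<open>F\<close> has a product law, and Fubini
  integrates \<open>r\<close> out while \<open>y\<close> is held fixed.\<close>

lemma (in prob_space) real_cond_exp_indep_shift:
  fixes r y :: "'a \<Rightarrow> real^'d"
  assumes sub: "subalgebra M F" and ind: "indep_set (sigma_sets (space M) {r -` A \<inter> space M |A. A \<in> sets borel}) (sets F)"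
    and r[measurable]: "r \<in> borel_measurable M"
    and yF: "y \<in> borel_measurable F"
  shows "AE \<omega> in M. real_cond_exp M F (indicator {\<omega> \<in> space M. r \<omega> + y \<omega> \<le> \<xi>}) \<omega> =
     prob {\<omega>' \<in> space M. r \<omega>' + y \<omega> \<le> \<xi>}"
proof -
  interpret finite_measure_subalgebra M F
    using sub by unfold_locales
  \<comment> \<open>The identity, regarded as a map into \<open>F\<close>, carries the whole
    sub-sigma-algebra: both \<open>y\<close> and an arbitrary test event of \<open>F\<close> become
    functions of the second factor.\<close>
  have idm[measurable]: "(\<lambda>\<omega>. \<omega>) \<in> measurable M F"
    using sub by (intro measurableI) (auto simp: subalgebra_def Int_absorb2 dest: sets.sets_into_space)
  note [measurable] = yF
  have [measurable]: "y \<in> borel_measurable M" using measurable_from_subalg[OF sub yF] .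
  have meas_le[measurable]: "{..\<xi>} \<in> sets borel" by (simp add: closed_eucl_atMost borel_closed)
  interpret R: prob_space "distr M borel r" by (rule prob_space_distr) simp
  interpret F: prob_space "distr M F (\<lambda>\<omega>. \<omega>)" by (rule prob_space_distr) simp
  interpret P: pair_prob_space "distr M borel r" "distr M F (\<lambda>\<omega>. \<omega>)" ..
  have prod: "distr M borel r \<Otimes>\<^sub>M distr M F (\<lambda>\<omega>. \<omega>) = distr M (borel \<Otimes>\<^sub>M F) (\<lambda>\<omega>. (r \<omega>, \<omega>))"
  proof (rule pair_measure_eqI)
    fix A :: "(real^'d) set" and B assume "A \<in> sets (distr M borel r)" "B \<in> sets (distr M F (\<lambda>\<omega>. \<omega>))"
    then have [measurable]: "A \<in> sets borel" "B \<in> sets F" by auto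
    have B: "B \<subseteq> space M" "B \<in> sets M" using sub sets.sets_into_space[of B F] by (auto simp: subalgebra_def)
    then have "(\<lambda>\<omega>. (r \<omega>, \<omega>)) -` (A \<times> B) \<inter> space M = (r -` A \<inter> space M) \<inter> B" "(\<lambda>\<omega>. \<omega>) -` B \<inter> space M = B"
      by auto
    moreover have "prob ((r -` A \<inter> space M) \<inter> B) = prob (r -` A \<inter> space M) * prob B"
      using \<open>A \<in> sets borel\<close> \<open>B \<in> sets F\<close>
      by (intro indep_setD[OF ind] sigma_sets.Basic) blast+
    ultimately show "emeasure (distr M borel r) A * emeasure (distr M F (\<lambda>\<omega>. \<omega>)) B =
        emeasure (distr M (borel \<Otimes>\<^sub>M F) (\<lambda>\<omega>. (r \<omega>, \<omega>))) (A \<times> B)"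
      by (simp add: emeasure_distr emeasure_eq_measure ennreal_mult)
  qed (auto simp: R.sigma_finite_measure_axioms F.sigma_finite_measure_axioms)
  have phi: "prob {\<omega>' \<in> space M. r \<omega>' + v \<le> \<xi>} = (LINT \<omega>'|M. indicator {..\<xi>} (r \<omega>' + v))" for v
  proof -
    have "(LINT \<omega>'|M. indicator {..\<xi>} (r \<omega>' + v) :: real) = (LINT \<omega>'|M. indicator {\<omega>' \<in> space M. r \<omega>' + v \<le> \<xi>} \<omega>')"
      by (intro Bochner_Integration.integral_cong) (auto simp: indicator_def)
    also have "\<dots> = prob ({\<omega>' \<in> space M. r \<omega>' + v \<le> \<xi>} \<inter> space M)"
      by (rule Bochner_Integration.integral_indicator)
    also have "{\<omega>' \<in> space M. r \<omega>' + v \<le> \<xi>} \<inter> space M = {\<omega>' \<in> space M. r \<omega>' + v \<le> \<xi>}" by auto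
    finally show ?thesis ..
  qed
  have set: "{\<omega> \<in> space M. r \<omega> + y \<omega> \<le> \<xi>} \<in> sets M"
  proof -
    have "{\<omega> \<in> space M. r \<omega> + y \<omega> \<in> {..\<xi>}} \<in> sets M" by measurable
    then show ?thesis by simp
  qed
  have phi_meas: "(\<lambda>\<omega>. LINT \<omega>'|M. indicator {..\<xi>} (r \<omega>' + y \<omega>) :: real) \<in> borel_measurable F"
    by (rule borel_measurable_lebesgue_integral) measurable
  show ?thesis
    unfolding phi
  proof (rule real_cond_exp_charact)
    fix A assume A[measurable]: "A \<in> sets F"
    define h :: "(real^'d) \<times> 'a \<Rightarrow> real" where "h p = indicator A (snd p) * indicator {..\<xi>} (fst p + y (snd p))" for p
    have [measurable]: "h \<in> borel_measurable (borel \<Otimes>\<^sub>M F)" unfolding h_def by measurable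
    have "set_lebesgue_integral M A (indicator {\<omega> \<in> space M. r \<omega> + y \<omega> \<le> \<xi>}) = (LINT \<omega>|M. h (r \<omega>, \<omega>))"
      unfolding set_lebesgue_integral_def h_def by (intro Bochner_Integration.integral_cong) (auto simp: indicator_def)
    also have "\<dots> = integral\<^sup>L (distr M (borel \<Otimes>\<^sub>M F) (\<lambda>\<omega>. (r \<omega>, \<omega>))) h"
      by (subst integral_distr) measurable
    also have "distr M (borel \<Otimes>\<^sub>M F) (\<lambda>\<omega>. (r \<omega>, \<omega>)) = distr M borel r \<Otimes>\<^sub>M distr M F (\<lambda>\<omega>. \<omega>)"
      by (rule prod[symmetric])
    also have "integral\<^sup>L \<dots> h = (LINT \<omega>|distr M F (\<lambda>\<omega>. \<omega>). LINT u|distr M borel r. h (u, \<omega>))"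
    proof -
      have "integrable (distr M borel r \<Otimes>\<^sub>M distr M F (\<lambda>\<omega>. \<omega>)) (case_prod (\<lambda>u \<omega>. h (u, \<omega>)))"
        by (rule P.integrable_const_bound[where B=1]) (auto simp: h_def indicator_def)
      from P.integral_snd[OF this] show ?thesis by (simp add: case_prod_beta')
    qed
    also have "\<dots> = (LINT \<omega>|M. LINT u|distr M borel r. h (u, \<omega>))"
    proof (rule integral_distr[OF idm])
      show "(\<lambda>\<omega>. LINT u|distr M borel r. h (u, \<omega>)) \<in> borel_measurable F"
        by (rule R.borel_measurable_lebesgue_integral) measurable
    qed
    also have "\<dots> = (LINT \<omega>|M. LINT \<omega>'|M. h (r \<omega>', \<omega>))"
      by (intro Bochner_Integration.integral_cong refl) (subst integral_distr; measurable)
    also have "\<dots> = set_lebesgue_integral M A (\<lambda>\<omega>. LINT \<omega>'|M. indicator {..\<xi>} (r \<omega>' + y \<omega>))"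
      unfolding set_lebesgue_integral_def h_def by simp
    finally show "set_lebesgue_integral M A (indicator {\<omega> \<in> space M. r \<omega> + y \<omega> \<le> \<xi>} :: 'a \<Rightarrow> real) =
        set_lebesgue_integral M A (\<lambda>\<omega>. LINT \<omega>'|M. indicator {..\<xi>} (r \<omega>' + y \<omega>))" .
  next
    show "integrable M (indicator {\<omega> \<in> space M. r \<omega> + y \<omega> \<le> \<xi>} :: 'a \<Rightarrow> real)"
      using set by (intro integrable_const_bound[where B=1] borel_measurable_indicator) (auto simp: indicator_def)
    show "integrable M (\<lambda>\<omega>. LINT \<omega>'|M. indicator {..\<xi>} (r \<omega>' + y \<omega>) :: real)"
      using measurable_from_subalg[OF sub phi_meas]
      by (intro integrable_const_bound[where B=1]) (simp_all flip: phi)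
  qed (rule phi_meas)
qed

text \<open>Lower orthants generate the Borel sets, are stable under intersection with corner
  \<open>inf a b\<close>, and exhaust the space along the corners (n, ..., n).\<close>

lemma finite_measure_eqI_atMost:
  fixes M1 M2 :: "(real^'d) measure"
  assumes "finite_measure M1" "sets M1 = sets borel" "sets M2 = sets borel"
    and eq: "\<And>\<xi>. emeasure M1 {..\<xi>} = emeasure M2 {..\<xi>}"
  shows "M1 = M2"
proof (rule measure_eqI_generator_eq)
  interpret finite_measure M1 by fact
  have b: "sets (borel :: (real^'d) measure) = sigma_sets UNIV (range atMost)"
    by (subst borel_eq_atMost) simp
  show "Int_stable (range (atMost :: real^'d \<Rightarrow> _))"
  proof (rule Int_stableI_image)
    fix a b :: "real^'d"
    show "\<exists>c\<in>UNIV. {..a} \<inter> {..b} = {..c}"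
      by (rule bexI[of _ "inf a b"]) auto
  qed
  show "sets M1 = sigma_sets UNIV (range atMost)" "sets M2 = sigma_sets UNIV (range atMost)"
    using assms b by auto
  show "emeasure M1 X = emeasure M2 X" if "X \<in> range atMost" for X using that eq by auto
  show "range (\<lambda>n. {..\<chi> _. real n}) \<subseteq> range (atMost :: real^'d \<Rightarrow> _)" by auto
  show "(\<Union>n. {..(\<chi> _. real n) :: real^'d}) = UNIV"
  proof (rule UNIV_eq_I[symmetric], rule UN_I)
    fix v :: "real^'d"
    have "v $ a \<le> real (nat \<lceil>norm v\<rceil>)" for a
      using component_le_norm_cart[of v a] of_nat_ceiling[of "norm v"] by linarith
    then show "v \<in> {..\<chi> _. real (nat \<lceil>norm v\<rceil>)}" by (simp add: less_eq_vec_def)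
  qed simp
  show "emeasure M1 {..\<chi> _. real n} \<noteq> \<infinity>" for n by (simp add: emeasure_eq_measure)
qed auto

text \<open>With \<open>g\<close> the conditional probability of \<open>A\<close> given \<open>F2\<close>, the distributions of \<open>X\<close> under the
  densities \<open>indicator A\<close> and \<open>g\<close> agree on the sets \<open>{..\<xi>}\<close>, hence have the same means.\<close>

lemma (in prob_space) cond_CDF_eq_imp_expectation_eq:
  fixes X :: "'a \<Rightarrow> real^'d"
  assumes sub1: "subalgebra M F1" and sub2: "subalgebra M F2"
    and [measurable]: "X \<in> borel_measurable M"
    and eq: "\<And>\<xi>. AE \<omega> in M. real_cond_exp M F1 (indicator {\<omega> \<in> space M. X \<omega> \<le> \<xi>}) \<omega> =
                real_cond_exp M F2 (indicator {\<omega> \<in> space M. X \<omega> \<le> \<xi>}) \<omega>"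
    and A: "A \<in> sets F1"
  shows "expectation (\<lambda>\<omega>. indicator A \<omega> * X \<omega> $ a) = expectation (\<lambda>\<omega>. real_cond_exp M F2 (indicator A) \<omega> * X \<omega> $ a)"
proof -
  interpret F1: finite_measure_subalgebra M F1 using sub1 by unfold_locales
  interpret F2: finite_measure_subalgebra M F2 using sub2 by unfold_locales
  have [measurable]: "{..\<xi>} \<in> sets borel" for \<xi> :: "real^'d" by (simp add: closed_eucl_atMost borel_closed)
  have A': "A \<in> sets M" using A sub1 by (auto simp: subalgebra_def)
  note [measurable] = A A'
  \<comment> \<open>The conditional probability is nonnegative only almost everywhere; the
    truncation gives a version that can serve as a density everywhere.\<close>
  define g where "g \<omega> = max 0 (real_cond_exp M F2 (indicator A) \<omega>)" for \<omega>
  have g0: "0 \<le> g \<omega>" for \<omega> by (simp add: g_def)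
  have [measurable]: "g \<in> borel_measurable M" unfolding g_def by measurable
  have iA: "integrable M (indicator A :: 'a \<Rightarrow> real)"
    by (rule integrable_const_bound[where B=1]) auto
  have "AE \<omega> in M. real_cond_exp M F2 (indicator A) \<omega> \<ge> 0"
    by (rule F2.real_cond_exp_pos) auto
  then have g: "AE \<omega> in M. real_cond_exp M F2 (indicator A) \<omega> = g \<omega>"
    by eventually_elim (simp add: g_def)
  have ig: "integrable M g"
    by (rule integrable_cong_AE_imp[OF F2.real_cond_exp_int(1)[OF iA]]) (use g in simp_all)
  have cdf: "(LINT \<omega>|M. indicator A \<omega> * indicator {..\<xi>} (X \<omega>)) = (LINT \<omega>|M. g \<omega> * indicator {..\<xi>} (X \<omega>))" for \<xi>
  proof -
    let ?E = "{\<omega> \<in> space M. X \<omega> \<le> \<xi>}"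
    have "{\<omega> \<in> space M. X \<omega> \<in> {..\<xi>}} \<in> sets M" by measurable
    then have [measurable]: "?E \<in> sets M" by simp
    have iE: "integrable M (indicator ?E :: 'a \<Rightarrow> real)"
      by (rule integrable_const_bound[where B=1]) (auto simp: indicator_def)
    have i1: "integrable M (\<lambda>\<omega>. indicator A \<omega> * indicator ?E \<omega> :: real)"
      by (rule integrable_const_bound[where B=1]) (auto simp: indicator_def)
    have bdd: "AE \<omega> in M. norm (real_cond_exp M F2 (indicator ?E) \<omega>) \<le> 1"
      using F2.real_cond_exp_pos[of "indicator ?E"] F2.real_cond_exp_le_c[OF iE, of 1]
      by (auto simp: indicator_def)
    have i2: "integrable M (\<lambda>\<omega>. real_cond_exp M F2 (indicator ?E) \<omega> * indicator A \<omega>)"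
      using bdd by (intro integrable_const_bound[where B=1]) (auto simp: indicator_def)
    have i3: "integrable M (\<lambda>\<omega>. real_cond_exp M F2 (indicator A) \<omega> * indicator ?E \<omega>)"
      using F2.real_cond_exp_int(1)[OF iA]
      by (rule Bochner_Integration.integrable_bound) (auto simp: indicator_def)
    \<comment> \<open>Since \<open>A\<close> lies in \<open>F1\<close>, the event \<open>?E\<close>
      may be replaced by its conditional probability given \<open>F1\<close>, by hypothesis the one
      given \<open>F2\<close>. Self-adjointness of conditioning on \<open>F2\<close> then moves the
      conditioning from \<open>?E\<close> to \<open>A\<close>.\<close>
    have "(LINT \<omega>|M. indicator A \<omega> * indicator {..\<xi>} (X \<omega>) :: real) = (LINT \<omega>|M. indicator A \<omega> * indicator ?E \<omega>)"
      by (intro Bochner_Integration.integral_cong) (auto simp: indicator_def)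
    also have "\<dots> = (LINT \<omega>|M. indicator A \<omega> * real_cond_exp M F1 (indicator ?E) \<omega>)"
      by (rule F1.real_cond_exp_intg(2)[symmetric]) (use i1 in auto)
    also have "\<dots> = (LINT \<omega>|M. real_cond_exp M F2 (indicator ?E) \<omega> * indicator A \<omega>)"
      using eq[of \<xi>] by (intro integral_cong_AE) (auto simp: measurable_from_subalg[OF sub1])
    also have "\<dots> = (LINT \<omega>|M. real_cond_exp M F2 (indicator ?E) \<omega> * real_cond_exp M F2 (indicator A) \<omega>)"
      by (rule F2.real_cond_exp_intg(2)[symmetric]) (use i2 in auto)
    also have "\<dots> = (LINT \<omega>|M. real_cond_exp M F2 (indicator A) \<omega> * real_cond_exp M F2 (indicator ?E) \<omega>)"
      by (simp add: mult.commute)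
    also have "\<dots> = (LINT \<omega>|M. real_cond_exp M F2 (indicator A) \<omega> * indicator ?E \<omega>)"
      by (rule F2.real_cond_exp_intg(2)) (use i3 in auto)
    also have "\<dots> = (LINT \<omega>|M. g \<omega> * indicator ?E \<omega>)"
      using g by (intro integral_cong_AE) auto
    also have "\<dots> = (LINT \<omega>|M. g \<omega> * indicator {..\<xi>} (X \<omega>))"
      by (intro Bochner_Integration.integral_cong) (auto simp: indicator_def)
    finally show ?thesis .
  qed
  have em: "emeasure (distr (density M w) borel X) {..\<xi>} = ennreal (LINT \<omega>|M. w \<omega> * indicator {..\<xi>} (X \<omega>))"
    if [measurable]: "w \<in> borel_measurable M" and w: "integrable M w" "\<And>\<omega>. 0 \<le> w \<omega>" for w :: "'a \<Rightarrow> real" and \<xi>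
  proof -
    have "integrable M (\<lambda>\<omega>. w \<omega> * indicator {..\<xi>} (X \<omega>))"
      using w(1) by (rule Bochner_Integration.integrable_bound) (auto simp: indicator_def)
    then have "ennreal (LINT \<omega>|M. w \<omega> * indicator {..\<xi>} (X \<omega>)) = (\<integral>\<^sup>+\<omega>. ennreal (w \<omega> * indicator {..\<xi>} (X \<omega>)) \<partial>M)"
      using w(2) by (intro nn_integral_eq_integral[symmetric]) auto
    also have "\<dots> = (\<integral>\<^sup>+\<omega>. ennreal (w \<omega>) * indicator (X -` {..\<xi>} \<inter> space M) \<omega> \<partial>M)"
      by (intro nn_integral_cong) (auto simp: indicator_def)
    finally show ?thesis
      by (simp add: emeasure_distr emeasure_density)
  qed
  have distr_eq: "distr (density M (indicator A :: 'a \<Rightarrow> real)) borel X = distr (density M g) borel X"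
  proof (rule finite_measure_eqI_atMost)
    show "finite_measure (distr (density M (indicator A :: 'a \<Rightarrow> real)) borel X)"
      by (rule finite_measure.finite_measure_distr[OF finite_measure_density_bounded[where K=1]]) auto
    show "emeasure (distr (density M (indicator A :: 'a \<Rightarrow> real)) borel X) {..\<xi>} = emeasure (distr (density M g) borel X) {..\<xi>}" for \<xi>
      by (subst (1 2) em) (use iA ig g0 cdf in auto)
  qed auto
  have Xa[measurable]: "(\<lambda>\<omega>. X \<omega> $ a) \<in> borel_measurable M"
    using borel_measurable_vec_iff[of X M] by simp
  from arg_cong[OF distr_eq, of "\<lambda>m. LINT v|m. v $ a"]
  have "(LINT \<omega>|M. indicator A \<omega> * X \<omega> $ a) = (LINT \<omega>|M. g \<omega> * X \<omega> $ a)"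
    using g0 Xa by (simp add: integral_distr integral_density)
  also have "\<dots> = (LINT \<omega>|M. real_cond_exp M F2 (indicator A) \<omega> * X \<omega> $ a)"
    using g by (intro integral_cong_AE) auto
  finally show ?thesis .
qed

section \<open>Linear regression\<close>

lemma (in prob_space) indep_set_imp_indep_var:
  assumes sub: "subalgebra M F"
    and ind: "indep_set (sigma_sets (space M) {r -` A \<inter> space M |A. A \<in> sets L}) (sets F)"
    and r: "r \<in> measurable M L" and f: "f \<in> borel_measurable L" and g: "g \<in> borel_measurable F"
  shows "indep_var borel (\<lambda>\<omega>. f (r \<omega>)) borel g"
  unfolding indep_var_eq
proof (intro conjI indep_setI)
  have spF: "space F = space M" and setF: "sets F \<subseteq> sets M" using sub by (auto simp: subalgebra_def)
  show "random_variable borel (\<lambda>\<omega>. f (r \<omega>))" using r f by measurable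
  show "random_variable borel g" by (rule measurable_from_subalg[OF sub g])
  have "(\<lambda>\<omega>. f (r \<omega>)) -` A \<inter> space M = r -` (f -` A \<inter> space L) \<inter> space M" for A
    using measurable_space[OF r] by auto
  then have 1: "sigma_sets (space M) {(\<lambda>\<omega>. f (r \<omega>)) -` A \<inter> space M |A. A \<in> sets borel} \<subseteq> sigma_sets (space M) {r -` A \<inter> space M |A. A \<in> sets L}"
    using measurable_sets[OF f] by (intro sigma_sets_mono) (blast intro: sigma_sets.Basic)
  have "sigma_sets (space F) {g -` A \<inter> space F |A. A \<in> sets borel} \<subseteq> sets F"
    using measurable_sets[OF g] by (intro sets.sigma_sets_subset) auto
  then have 2: "sigma_sets (space M) {g -` A \<inter> space M |A. A \<in> sets borel} \<subseteq> sets F"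
    by (simp only: spF)
  show "sigma_sets (space M) {(\<lambda>\<omega>. f (r \<omega>)) -` A \<inter> space M |A. A \<in> sets borel} \<subseteq> events"
    using 1 indep_setD_ev1[OF ind] by (rule subset_trans)
  show "sigma_sets (space M) {g -` A \<inter> space M |A. A \<in> sets borel} \<subseteq> events"
    using 2 setF by (rule subset_trans)
  show "prob (a \<inter> b) = prob a * prob b"
    if "a \<in> sigma_sets (space M) {(\<lambda>\<omega>. f (r \<omega>)) -` A \<inter> space M |A. A \<in> sets borel}"
      "b \<in> sigma_sets (space M) {g -` A \<inter> space M |A. A \<in> sets borel}" for a b
    by (rule indep_setD[OF ind subsetD[OF 1 that(1)] subsetD[OF 2 that(2)]])
qed

section \<open>Second-order calculus for vectors with components in the Gaussian span\<close>

context gaussian_family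
begin

definition gvec :: "('a \<Rightarrow> real^'e) set" where
  "gvec = {r. \<forall>a. (\<lambda>\<omega>. r \<omega> $ a) \<in> gspan}"

lemma gvecD: "r \<in> gvec \<Longrightarrow> (\<lambda>\<omega>. r \<omega> $ a) \<in> gspan"
  by (simp add: gvec_def)

lemma gvec_x: "k \<le> N \<Longrightarrow> x k \<in> gvec"
  by (simp add: gvec_def gspan_component)

lemma gvec_zero: "(\<lambda>_. 0) \<in> gvec"
  by (simp add: gvec_def gspan_zero)

lemma gvec_add: "r \<in> gvec \<Longrightarrow> s \<in> gvec \<Longrightarrow> (\<lambda>\<omega>. r \<omega> + s \<omega>) \<in> gvec"
  by (simp add: gvec_def gspan_add)

lemma gvec_diff: "r \<in> gvec \<Longrightarrow> s \<in> gvec \<Longrightarrow> (\<lambda>\<omega>. r \<omega> - s \<omega>) \<in> gvec"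
  by (simp add: gvec_def gspan_diff)

lemma gvec_sum: "(\<And>i. i \<in> S \<Longrightarrow> r i \<in> gvec) \<Longrightarrow> (\<lambda>\<omega>. \<Sum>i\<in>S. r i \<omega>) \<in> gvec"
  by (simp add: gvec_def gspan_sum)

lemma gvec_mult: "r \<in> gvec \<Longrightarrow> (\<lambda>\<omega>. A *v r \<omega>) \<in> gvec"
  by (simp add: gvec_def matrix_vector_mult_def gspan_sum gspan_scale)

lemmas gvec_intros = gvec_x gvec_zero gvec_add gvec_diff gvec_sum gvec_mult

lemma gvec_measurable: "r \<in> gvec \<Longrightarrow> r \<in> borel_measurable M"
  by (auto simp: borel_measurable_vec_iff gvec_def gspan_measurable)

lemma gvec_integrable: "r \<in> gvec \<Longrightarrow> integrable M r"
  by (intro integrable_vecI gspan_integrable gvecD)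

lemma gvec_mean: "r \<in> gvec \<Longrightarrow> (\<integral>\<omega>. r \<omega> \<partial>M) = 0"
proof -
  assume r: "r \<in> gvec"
  have "(\<integral>\<omega>. r \<omega> \<partial>M) $ a = 0" for a
    using integral_bounded_linear[OF bounded_linear_vec_nth gvec_integrable[OF r], of a] gspan_mean[OF gvecD[OF r, of a]]
    by simp
  then show ?thesis by (simp add: vec_eq_iff)
qed

lemma cross_cov_gvec:
  assumes "r \<in> gvec" "s \<in> gvec"
  shows "cross_cov M r s $ a $ b = expectation (\<lambda>\<omega>. r \<omega> $ a * s \<omega> $ b)"
  using assms by (simp add: cross_cov_def gvec_mean)

lemma gvec_integrable_mult: "r \<in> gvec \<Longrightarrow> s \<in> gvec \<Longrightarrow> integrable M (\<lambda>\<omega>. r \<omega> $ a * s \<omega> $ b)"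
  by (rule gspan_integrable_mult) (rule gvecD; assumption)+

lemma cross_cov_transpose: "transpose (cross_cov M r s) = cross_cov M s r"
  unfolding cross_cov_def transpose_def by (simp only: vec_eq_iff vec_lambda_beta) (intro allI Bochner_Integration.integral_cong refl mult.commute)

lemma cross_cov_eq_0_commute: "cross_cov M r s = 0 \<Longrightarrow> cross_cov M s r = 0"
  using cross_cov_transpose[of r s] by (simp add: transpose_def vec_eq_iff)

lemma cross_cov_add_left:
  "r \<in> gvec \<Longrightarrow> r' \<in> gvec \<Longrightarrow> s \<in> gvec \<Longrightarrow> cross_cov M (\<lambda>\<omega>. r \<omega> + r' \<omega>) s = cross_cov M r s + cross_cov M r' s"
  by (simp add: vec_eq_iff cross_cov_gvec gvec_add distrib_right gvec_integrable_mult)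

lemma cross_cov_diff_left:
  "r \<in> gvec \<Longrightarrow> r' \<in> gvec \<Longrightarrow> s \<in> gvec \<Longrightarrow> cross_cov M (\<lambda>\<omega>. r \<omega> - r' \<omega>) s = cross_cov M r s - cross_cov M r' s"
  by (simp add: vec_eq_iff cross_cov_gvec gvec_diff left_diff_distrib gvec_integrable_mult)

lemma cross_cov_zero_left: "s \<in> gvec \<Longrightarrow> cross_cov M (\<lambda>_. 0) s = 0"
  by (simp add: vec_eq_iff cross_cov_gvec gvec_zero)

lemma cross_cov_mult_left:
  "r \<in> gvec \<Longrightarrow> s \<in> gvec \<Longrightarrow> cross_cov M (\<lambda>\<omega>. A *v r \<omega>) s = A ** cross_cov M r s"
  unfolding vec_eq_iff
  by (simp add: cross_cov_gvec gvec_mult matrix_matrix_mult_def)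
    (simp add: matrix_vector_mult_def sum_distrib_right mult.assoc gvec_integrable_mult)

lemma cross_cov_sum_left:
  assumes "\<And>i. i \<in> S \<Longrightarrow> r i \<in> gvec" "s \<in> gvec"
  shows "cross_cov M (\<lambda>\<omega>. \<Sum>i\<in>S. r i \<omega>) s = (\<Sum>i\<in>S. cross_cov M (r i) s)"
  using assms
  by (induction S rule: infinite_finite_induct) (simp_all add: cross_cov_zero_left cross_cov_add_left gvec_sum)

lemma cross_cov_add_right:
  "r \<in> gvec \<Longrightarrow> r' \<in> gvec \<Longrightarrow> s \<in> gvec \<Longrightarrow> cross_cov M s (\<lambda>\<omega>. r \<omega> + r' \<omega>) = cross_cov M s r + cross_cov M s r'"
  by (simp add: vec_eq_iff cross_cov_gvec gvec_add distrib_left gvec_integrable_mult)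

lemma cross_cov_diff_right:
  "r \<in> gvec \<Longrightarrow> r' \<in> gvec \<Longrightarrow> s \<in> gvec \<Longrightarrow> cross_cov M s (\<lambda>\<omega>. r \<omega> - r' \<omega>) = cross_cov M s r - cross_cov M s r'"
  by (simp add: vec_eq_iff cross_cov_gvec gvec_diff right_diff_distrib gvec_integrable_mult)

lemma cross_cov_mult_right:
  assumes "r \<in> gvec" "s \<in> gvec"
  shows "cross_cov M s (\<lambda>\<omega>. A *v r \<omega>) = cross_cov M s r ** transpose A"
proof -
  have "cross_cov M s (\<lambda>\<omega>. A *v r \<omega>) = transpose (A ** cross_cov M r s)"
    unfolding cross_cov_mult_left[OF assms, symmetric] by (rule cross_cov_transpose[symmetric])
  then show ?thesis by (simp only: matrix_transpose_mul cross_cov_transpose)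
qed

lemma cross_cov_sum_right:
  assumes "\<And>i. i \<in> S \<Longrightarrow> r i \<in> gvec" "s \<in> gvec"
  shows "cross_cov M s (\<lambda>\<omega>. \<Sum>i\<in>S. r i \<omega>) = (\<Sum>i\<in>S. cross_cov M s (r i))"
proof -
  have "cross_cov M s (\<lambda>_. 0) = 0"
    by (rule cross_cov_eq_0_commute[OF cross_cov_zero_left[OF assms(2)]])
  then show ?thesis using assms
    by (induction S rule: infinite_finite_induct) (simp_all add: cross_cov_add_right gvec_sum)
qed

text \<open>A Gram-Schmidt step. After \<open>f\<close> and the new regressor \<open>v u\<close>
  have been regressed on the old ones, the remainder \<open>w\<close> of \<open>v u\<close> is
  removed from the remainder of \<open>f\<close>. The result is orthogonal to \<open>w\<close> and
  to the old regressors, hence to \<open>v u\<close>. The regressors may be linearly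
  dependent.\<close>

lemma scalar_regression:
  assumes "finite S" "\<And>s. s \<in> S \<Longrightarrow> v s \<in> gspan" "f \<in> gspan"
  shows "\<exists>c. \<forall>t\<in>S. expectation (\<lambda>\<omega>. (f \<omega> - (\<Sum>s\<in>S. c s * v s \<omega>)) * v t \<omega>) = 0"
  using assms
proof (induction S arbitrary: f rule: finite_induct)
  case empty
  then show ?case by simp
next
  case (insert u S)
  have v: "v s \<in> gspan" if "s \<in> insert u S" for s using insert.prems that by blast
  obtain c where c: "\<And>t. t \<in> S \<Longrightarrow> expectation (\<lambda>\<omega>. (f \<omega> - (\<Sum>s\<in>S. c s * v s \<omega>)) * v t \<omega>) = 0"
    using insert.IH[of f] insert.prems by blast
  obtain d where d: "\<And>t. t \<in> S \<Longrightarrow> expectation (\<lambda>\<omega>. (v u \<omega> - (\<Sum>s\<in>S. d s * v s \<omega>)) * v t \<omega>) = 0"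
    using insert.IH[of "v u"] insert.prems by blast
  define f' where "f' = (\<lambda>\<omega>. f \<omega> - (\<Sum>s\<in>S. c s * v s \<omega>))"
  define w where "w = (\<lambda>\<omega>. v u \<omega> - (\<Sum>s\<in>S. d s * v s \<omega>))"
  have gs: "f' \<in> gspan" "w \<in> gspan"
    unfolding f'_def w_def using insert.prems by (auto intro!: gspan_diff gspan_sum gspan_scale)
  define \<alpha> where "\<alpha> = expectation (\<lambda>\<omega>. f' \<omega> * w \<omega>) / expectation (\<lambda>\<omega>. w \<omega> * w \<omega>)"
  \<comment> \<open>If \<open>w\<close> vanishes almost everywhere, then \<open>\<alpha> = 0\<close> by the convention \<open>x / 0 = 0\<close>.\<close>
  define q where "q = (\<lambda>\<omega>. f' \<omega> - \<alpha> * w \<omega>)"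
  have q: "q \<in> gspan" unfolding q_def by (intro gspan_diff gspan_scale gs)
  have qS: "expectation (\<lambda>\<omega>. q \<omega> * v t \<omega>) = 0" if "t \<in> S" for t
    using c[OF that, folded fun_cong[OF f'_def]] d[OF that, folded fun_cong[OF w_def]] gspan_integrable_mult[OF gs(1) v[of t]] gspan_integrable_mult[OF gs(2) v[of t]] that
    by (simp add: q_def left_diff_distrib mult.assoc)
  have fw: "expectation (\<lambda>\<omega>. f' \<omega> * w \<omega>) = \<alpha> * expectation (\<lambda>\<omega>. w \<omega> * w \<omega>)"
  proof (cases "expectation (\<lambda>\<omega>. w \<omega> * w \<omega>) = 0")
    case True
    then have "AE \<omega> in M. w \<omega> * w \<omega> = 0"
      using integral_nonneg_eq_0_iff_AE[OF gspan_integrable_mult[OF gs(2) gs(2)]] by simp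
    then have "expectation (\<lambda>\<omega>. f' \<omega> * w \<omega>) = expectation (\<lambda>_. 0)"
      using gs[THEN gspan_measurable] by (intro integral_cong_AE) auto
    then show ?thesis using True by simp
  qed (simp add: \<alpha>_def)
  have "expectation (\<lambda>\<omega>. q \<omega> * w \<omega>) = 0"
    using fw gspan_integrable_mult[OF gs] gspan_integrable_mult[OF gs(2) gs(2)]
    by (simp add: q_def left_diff_distrib mult.assoc)
  moreover have "expectation (\<lambda>\<omega>. q \<omega> * v u \<omega>) = expectation (\<lambda>\<omega>. q \<omega> * w \<omega> + (\<Sum>s\<in>S. d s * (q \<omega> * v s \<omega>)))"
    by (simp add: w_def algebra_simps sum_distrib_left)
  ultimately have "expectation (\<lambda>\<omega>. q \<omega> * v u \<omega>) = 0"
    using qS gspan_integrable_mult[OF q gs(2)] gspan_integrable_mult[OF q v] by simp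
  then have "\<forall>t\<in>insert u S. expectation (\<lambda>\<omega>. q \<omega> * v t \<omega>) = 0" using qS by auto
  moreover have "q = (\<lambda>\<omega>. f \<omega> - (\<Sum>s\<in>insert u S. (if s = u then \<alpha> else c s - \<alpha> * d s) * v s \<omega>))"
  proof
    fix \<omega>
    have "(\<Sum>s\<in>S. (if s = u then \<alpha> else c s - \<alpha> * d s) * v s \<omega>) = (\<Sum>s\<in>S. c s * v s \<omega>) - \<alpha> * (\<Sum>s\<in>S. d s * v s \<omega>)"
      using insert.hyps by (auto simp: sum_distrib_left left_diff_distrib mult.assoc simp flip: sum_subtractf intro!: sum.cong)
    then show "q \<omega> = f \<omega> - (\<Sum>s\<in>insert u S. (if s = u then \<alpha> else c s - \<alpha> * d s) * v s \<omega>)"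
      using insert.hyps by (simp add: q_def f'_def w_def algebra_simps)
  qed
  ultimately show ?case by (intro exI[of _ "\<lambda>s. if s = u then \<alpha> else c s - \<alpha> * d s"]) simp
qed

text \<open>The coefficients are a free parameter, since singular covariances do not determine them.
  It is a regression residual once it is uncorrelated with \<open>x j\<close> for all
  \<open>j\<close> in \<open>J\<close>.\<close>

definition residual :: "nat \<Rightarrow> nat set \<Rightarrow> (nat \<Rightarrow> real^'d^'d) \<Rightarrow> 'a \<Rightarrow> real^'d" where
  "residual k J A = (\<lambda>\<omega>. x k \<omega> - (\<Sum>j\<in>J. A j *v x j \<omega>))"

lemma gvec_residual: "k \<le> N \<Longrightarrow> J \<subseteq> {..N} \<Longrightarrow> residual k J A \<in> gvec"
  unfolding residual_def by (intro gvec_intros) auto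

text \<open>Each row of the coefficient matrices comes from a scalar regression of one component of
  \<open>x k\<close> on all components of the \<open>x j\<close>.\<close>

lemma regression:
  assumes k: "k \<le> N" and J: "J \<subseteq> {..N}"
  obtains A where "\<And>j. j \<in> J \<Longrightarrow> cross_cov M (residual k J A) (x j) = 0"
proof -
  let ?S = "J \<times> (UNIV :: 'd set)"
  have fin: "finite ?S" using J by (simp add: finite_subset)
  have "\<exists>c. \<forall>t\<in>?S. expectation (\<lambda>\<omega>. (x k \<omega> $ a - (\<Sum>s\<in>?S. c s * x (fst s) \<omega> $ snd s)) * x (fst t) \<omega> $ snd t) = 0" for a
    using J by (intro scalar_regression[OF fin] gspan_component k) auto
  then have "\<exists>c. \<forall>a. \<forall>t\<in>?S. expectation (\<lambda>\<omega>. (x k \<omega> $ a - (\<Sum>s\<in>?S. c a s * x (fst s) \<omega> $ snd s)) * x (fst t) \<omega> $ snd t) = 0"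
    by (intro choice allI)
  then obtain c where c: "\<forall>a. \<forall>t\<in>?S. expectation (\<lambda>\<omega>. (x k \<omega> $ a - (\<Sum>s\<in>?S. c a s * x (fst s) \<omega> $ snd s)) * x (fst t) \<omega> $ snd t) = 0"
    by (rule exE)
  define A :: "nat \<Rightarrow> real^'d^'d" where "A j = (\<chi> a b. c a (j, b))" for j
  have comp: "residual k J A \<omega> $ a = x k \<omega> $ a - (\<Sum>s\<in>?S. c a s * x (fst s) \<omega> $ snd s)" for \<omega> a
    by (simp add: residual_def A_def matrix_vector_mult_def sum.cartesian_product case_prod_beta')
  have "cross_cov M (residual k J A) (x j) = 0" if "j \<in> J" for j
  proof -
    have j: "j \<le> N" using that J by auto
    show ?thesis
      using that bspec[OF spec[OF c], of "(j, _)"]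
      by (simp add: vec_eq_iff cross_cov_gvec[OF gvec_residual[OF k J] gvec_x[OF j]] comp)
  qed
  then show ?thesis by (rule that)
qed

lemma gvec_uncorrelated_imp_indep_set:
  assumes "r \<in> gvec" "I \<subseteq> {..N}" "\<And>i. i \<in> I \<Longrightarrow> cross_cov M r (x i) = 0"
  shows "indep_set (sigma_sets (space M) {r -` A \<inter> space M |A. A \<in> sets borel}) (sets (gen_by M x I))"
proof (rule uncorrelated_imp_indep_set)
  fix i a b assume "i \<in> I"
  then show "expectation (\<lambda>\<omega>. r \<omega> $ a * x i \<omega> $ b) = 0"
    using assms cross_cov_gvec[of r "x i" a b] by (auto simp: gvec_x subset_iff)
qed (use assms in \<open>auto simp: gvecD\<close>)

lemma prediction_measurable:
  "J \<subseteq> I \<Longrightarrow> (\<lambda>\<omega>. \<Sum>j\<in>J. A j *v x j \<omega>) \<in> borel_measurable (gen_by M x I)"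
  using measurable_gen_by[of _ I x M]
  by (intro borel_measurable_sum)
    (auto intro!: borel_measurable_continuous_on[OF linear_continuous_on[OF matrix_vector_mul_bounded_linear]])

text \<open>For every index set \<open>K\<close> between \<open>J\<close> and \<open>I\<close> the
  residual is independent of \<open>gen_by M x K\<close> while the prediction is measurable with
  respect to it. Freezing then gives a formula that does not mention \<open>K\<close>; it is
  compared at \<open>I\<close> and at \<open>J\<close>.\<close>

lemma uncorrelated_imp_cond_CDF_eq:
  assumes k: "k \<le> N" and JI: "J \<subseteq> I" and I: "I \<subseteq> {..N}"
    and unc: "\<And>i. i \<in> I \<Longrightarrow> cross_cov M (residual k J A) (x i) = 0"
  shows "AE \<omega> in M. cond_CDF M (x k) x I \<xi> \<omega> = cond_CDF M (x k) x J \<xi> \<omega>"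
proof -
  let ?r = "residual k J A"
  define y where "y = (\<lambda>\<omega>. \<Sum>j\<in>J. A j *v x j \<omega>)"
  have r: "?r \<in> gvec" using k JI I by (intro gvec_residual) auto
  have *: "AE \<omega> in M. cond_CDF M (x k) x K \<xi> \<omega> = prob {\<omega>' \<in> space M. ?r \<omega>' + y \<omega> \<le> \<xi>}"
    if K: "J \<subseteq> K" "K \<subseteq> I" for K
  proof -
    have "AE \<omega> in M. real_cond_exp M (gen_by M x K) (indicator {\<omega> \<in> space M. ?r \<omega> + y \<omega> \<le> \<xi>}) \<omega> =
        prob {\<omega>' \<in> space M. ?r \<omega>' + y \<omega> \<le> \<xi>}"
    proof (rule real_cond_exp_indep_shift)
      show "subalgebra M (gen_by M x K)"
        using K I by (intro subalgebra_gen_by measurable_x) auto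
      show "indep_set (sigma_sets (space M) {?r -` A \<inter> space M |A. A \<in> sets borel}) (sets (gen_by M x K))"
        using K I unc by (intro gvec_uncorrelated_imp_indep_set r) auto
      show "y \<in> borel_measurable (gen_by M x K)"
        unfolding y_def using K by (intro prediction_measurable)
    qed (rule gvec_measurable[OF r])
    then show ?thesis by (simp add: cond_CDF_def residual_def y_def)
  qed
  from *[of I] *[of J] JI show ?thesis by auto
qed

text \<open>Take an event \<open>E\<close> of the larger sigma-algebra. Equality of the CDFs lets
  \<open>E\<close> be replaced by its conditional probability given the smaller one when integrating
  \<open>x k\<close>. The prediction allows the same replacement by measurability, so the residual
  does too; but being independent of the smaller sigma-algebra and centred, it integrates to
  zero.\<close>

lemma cond_CDF_eq_imp_uncorrelated:
  assumes k: "k \<le> N" and JI: "J \<subseteq> I" and I: "I \<subseteq> {..N}"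
    and eq: "\<And>\<xi>. AE \<omega> in M. cond_CDF M (x k) x I \<xi> \<omega> = cond_CDF M (x k) x J \<xi> \<omega>"
    and unc: "\<And>j. j \<in> J \<Longrightarrow> cross_cov M (residual k J A) (x j) = 0"
    and i: "i \<in> I"
  shows "cross_cov M (residual k J A) (x i) = 0"
proof -
  let ?r = "residual k J A" and ?F = "gen_by M x I" and ?H = "gen_by M x J"
  define y where "y = (\<lambda>\<omega>. \<Sum>j\<in>J. A j *v x j \<omega>)"
  have J: "J \<subseteq> {..N}" using JI I by auto
  have r: "?r \<in> gvec" using k J by (intro gvec_residual)
  have yg: "y \<in> gvec" unfolding y_def using J by (intro gvec_intros) auto
  have xr: "x k \<omega> = y \<omega> + ?r \<omega>" for \<omega> by (simp add: residual_def y_def)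
  have subF: "subalgebra M ?F" using I by (intro subalgebra_gen_by measurable_x) auto
  have subH: "subalgebra M ?H" using J by (intro subalgebra_gen_by measurable_x) auto
  interpret F: finite_measure_subalgebra M ?F using subF by unfold_locales
  interpret H: finite_measure_subalgebra M ?H using subH by unfold_locales
  note meas = gspan_measurable[OF gvecD[OF r]] gspan_measurable[OF gvecD[OF yg]]
  have yH: "(\<lambda>\<omega>. y \<omega> $ a) \<in> borel_measurable ?H" for a
    using prediction_measurable[of J J A, unfolded borel_measurable_vec_iff] by (simp add: y_def)
  have zero: "expectation (\<lambda>\<omega>. indicator E \<omega> * ?r \<omega> $ a) = 0" if E: "E \<in> sets ?F" for E a
  proof -
    let ?g = "real_cond_exp M ?H (indicator E)"
    have EM: "E \<in> sets M" using E subF by (auto simp: subalgebra_def)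
    have ind: "indep_var borel (\<lambda>\<omega>. ?r \<omega> $ a) borel ?g"
      by (rule indep_set_imp_indep_var[OF subH gvec_uncorrelated_imp_indep_set[OF r J unc] gvec_measurable[OF r]])
        (use borel_measurable_vec_iff[of "\<lambda>v. v"] in simp_all)
    have iE: "integrable M (indicator E :: 'a \<Rightarrow> real)"
      using EM by (intro integrable_const_bound[where B=1]) auto
    have gr: "expectation (\<lambda>\<omega>. ?r \<omega> $ a * ?g \<omega>) = 0"
      using indep_var_lebesgue_integral[OF ind gspan_integrable[OF gvecD[OF r]] H.real_cond_exp_int(1)[OF iE]]
        gspan_mean[OF gvecD[OF r]] by simp
    have "expectation (\<lambda>\<omega>. indicator E \<omega> * x k \<omega> $ a) = expectation (\<lambda>\<omega>. ?g \<omega> * x k \<omega> $ a)"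
      using eq E by (intro cond_CDF_eq_imp_expectation_eq[OF subF subH measurable_x[OF k]]) (auto simp: cond_CDF_def)
    have igr: "integrable M (\<lambda>\<omega>. ?r \<omega> $ a * ?g \<omega>)"
      by (rule indep_var_integrable[OF ind gspan_integrable[OF gvecD[OF r]] H.real_cond_exp_int(1)[OF iE]])
    have iyE: "integrable M (\<lambda>\<omega>. y \<omega> $ a * indicator E \<omega>)" and irE: "integrable M (\<lambda>\<omega>. ?r \<omega> $ a * indicator E \<omega>)"
      using integrable_mult_indicator[OF EM gspan_integrable[OF gvecD[OF yg, of a]]]
        integrable_mult_indicator[OF EM gspan_integrable[OF gvecD[OF r, of a]]]
      by (simp_all add: mult.commute)
    have iyg: "integrable M (\<lambda>\<omega>. y \<omega> $ a * ?g \<omega>)"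
      and yg_eq: "expectation (\<lambda>\<omega>. y \<omega> $ a * ?g \<omega>) = expectation (\<lambda>\<omega>. y \<omega> $ a * indicator E \<omega>)"
      by (rule H.real_cond_exp_intg[OF iyE yH borel_measurable_indicator[OF EM]])+
    have "expectation (\<lambda>\<omega>. y \<omega> $ a * indicator E \<omega>) + expectation (\<lambda>\<omega>. ?r \<omega> $ a * indicator E \<omega>) =
        expectation (\<lambda>\<omega>. indicator E \<omega> * x k \<omega> $ a)"
      using Bochner_Integration.integral_add[OF iyE irE] by (simp add: xr algebra_simps)
    also have "\<dots> = expectation (\<lambda>\<omega>. ?g \<omega> * x k \<omega> $ a)" by fact
    also have "\<dots> = expectation (\<lambda>\<omega>. y \<omega> $ a * ?g \<omega>) + expectation (\<lambda>\<omega>. ?r \<omega> $ a * ?g \<omega>)"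
      using Bochner_Integration.integral_add[OF iyg igr] by (simp add: xr algebra_simps)
    finally show ?thesis using gr yg_eq by (simp add: mult.commute)
  qed
  \<comment> \<open>Vanishing integrals over all events of \<open>?F\<close> mean vanishing
    conditional expectation, which can then be paired with the unbounded variable
    \<open>x i\<close>.\<close>
  have ce: "AE \<omega> in M. real_cond_exp M ?F (\<lambda>\<omega>. ?r \<omega> $ a) \<omega> = 0" for a
    using zero gspan_integrable[OF gvecD[OF r]]
    by (intro F.real_cond_exp_charact) (simp_all add: set_lebesgue_integral_def)
  have iN: "i \<le> N" using i I by auto
  have "expectation (\<lambda>\<omega>. ?r \<omega> $ a * x i \<omega> $ b) = 0" for a b
  proof -
    have "expectation (\<lambda>\<omega>. x i \<omega> $ b * ?r \<omega> $ a) = expectation (\<lambda>\<omega>. x i \<omega> $ b * real_cond_exp M ?F (\<lambda>\<omega>. ?r \<omega> $ a) \<omega>)"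
      using measurable_gen_by[OF i, of x M] borel_measurable_vec_iff[of "x i" ?F]
      by (intro F.real_cond_exp_intg(2)[symmetric] gvec_integrable_mult gvec_x iN r meas) simp
    also have "\<dots> = expectation (\<lambda>_. 0)"
      using ce[of a] gspan_measurable[OF gspan_component[OF iN, of b]] by (intro integral_cong_AE) auto
    finally show ?thesis by (simp add: mult.commute)
  qed
  then show ?thesis by (simp add: vec_eq_iff cross_cov_gvec[OF r gvec_x[OF iN]])
qed

end

section \<open>Block matrices\<close>

lemma matrix_mult_add_left: "(A + B) ** (C :: real^'n^'m) = A ** C + B ** C"
  by (simp add: matrix_matrix_mult_def vec_eq_iff distrib_right sum.distrib)

lemma matrix_mult_sum_left: "(\<Sum>i\<in>S. A i) ** (B :: real^'n^'m) = (\<Sum>i\<in>S. A i ** B)"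
  by (induction S rule: infinite_finite_induct) (simp_all add: matrix_mult_add_left)

lemma matrix_mult_sum_right: "(B :: real^'n^'m) ** (\<Sum>i\<in>S. A i) = (\<Sum>i\<in>S. B ** A i)"
  by (induction S rule: infinite_finite_induct) (simp_all add: matrix_add_ldistrib)

lemma transpose_sum: "transpose (\<Sum>i\<in>S. A i) = (\<Sum>i\<in>S. transpose (A i) :: real^'n^'m)"
  by (simp add: transpose_def vec_eq_iff)

lemma matrix_vector_mult_uminus_left: "(- A) *v v = - ((A :: real^'n^'m) *v v)"
  by (simp add: matrix_vector_mult_def vec_eq_iff sum_negf)

lemma transpose_add: "transpose (A + B :: real^'n^'m) = transpose A + transpose B"
  by (simp add: transpose_def vec_eq_iff)

lemma transpose_zero: "transpose (0 :: real^'n^'m) = 0"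
  by (simp add: transpose_def vec_eq_iff)

lemma bmat_mult_assoc: "bmat_mult N (bmat_mult N A B) C = bmat_mult N A (bmat_mult N B C)"
proof (intro ext)
  fix i j
  have "(\<Sum>l\<le>N. (\<Sum>m\<le>N. A i m ** B m l) ** C l j) = (\<Sum>l\<le>N. \<Sum>m\<le>N. A i m ** B m l ** C l j)"
    by (simp only: matrix_mult_sum_left)
  also have "\<dots> = (\<Sum>m\<le>N. \<Sum>l\<le>N. A i m ** B m l ** C l j)" by (rule sum.swap)
  also have "\<dots> = (\<Sum>m\<le>N. A i m ** (\<Sum>l\<le>N. B m l ** C l j))"
    by (simp only: matrix_mult_sum_right matrix_mul_assoc)
  finally show "bmat_mult N (bmat_mult N A B) C i j = bmat_mult N A (bmat_mult N B C) i j"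
    by (simp only: bmat_mult_def)
qed

lemma bmat_mult_one_left: "bmat_is_one N A \<Longrightarrow> i \<le> N \<Longrightarrow> bmat_mult N A B i j = B i j"
  by (simp add: bmat_is_one_def bmat_mult_def if_distrib[of "\<lambda>X. X ** _"] cong: if_cong)

lemma bmat_mult_one_right: "bmat_is_one N B \<Longrightarrow> j \<le> N \<Longrightarrow> bmat_mult N A B i j = A i j"
  by (simp add: bmat_is_one_def bmat_mult_def if_distrib[of "\<lambda>X. _ ** X"] cong: if_cong)

lemma bmat_mult_cong:
  assumes "\<And>i j. i \<le> N \<Longrightarrow> j \<le> N \<Longrightarrow> A i j = A' i j" "\<And>i j. i \<le> N \<Longrightarrow> j \<le> N \<Longrightarrow> B i j = B' i j" "i \<le> N" "j \<le> N"
  shows "bmat_mult N A B i j = bmat_mult N A' B' i j"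
  using assms by (simp add: bmat_mult_def)

lemma bmat_transpose_mult: "bmat_transpose (bmat_mult N A B) = bmat_mult N (bmat_transpose B) (bmat_transpose A)"
  by (simp add: bmat_transpose_def bmat_mult_def fun_eq_iff transpose_sum matrix_transpose_mul)

lemma bmat_is_one_transpose: "bmat_is_one N A \<Longrightarrow> bmat_is_one N (bmat_transpose A)"
  by (auto simp: bmat_is_one_def bmat_transpose_def transpose_mat transpose_zero)

definition bmat_invertible :: "nat \<Rightarrow> 'd::finite bmat \<Rightarrow> bool" where
  "bmat_invertible N A \<longleftrightarrow> (\<exists>B. bmat_is_one N (bmat_mult N A B) \<and> bmat_is_one N (bmat_mult N B A))"

lemma bmat_inv_is_inverse:
  assumes "bmat_invertible N A"
  shows "bmat_is_one N (bmat_mult N A (bmat_inv N A))" "bmat_is_one N (bmat_mult N (bmat_inv N A) A)"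
  using someI_ex[OF assms[unfolded bmat_invertible_def]] by (simp_all add: bmat_inv_def)

lemma bmat_invertible_transpose: "bmat_invertible N A \<Longrightarrow> bmat_invertible N (bmat_transpose A)"
  unfolding bmat_invertible_def by (metis bmat_is_one_transpose bmat_transpose_mult)

text \<open>Used with the covariance of \<open>x\<close> as \<open>C\<close> and that of the noise
  as \<open>D\<close>. Blocks beyond \<open>N\<close> carry no information, so the equation and the
  cancellation are confined to indices up to \<open>N\<close>.\<close>

lemma bmat_congruence_cancel:
  assumes A: "bmat_invertible N A"
    and D: "\<And>i j. i \<le> N \<Longrightarrow> j \<le> N \<Longrightarrow> D i j = bmat_mult N (bmat_mult N A C) (bmat_transpose A) i j"
    and ij: "i \<le> N" "j \<le> N"
  shows "bmat_mult N (bmat_mult N (bmat_inv N A) D) (bmat_inv N (bmat_transpose A)) i j = C i j"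
proof -
  let ?I = "bmat_inv N A" and ?T = "bmat_transpose A"
  let ?J = "bmat_inv N ?T"
  have "bmat_mult N (bmat_mult N ?I D) ?J i j = bmat_mult N (bmat_mult N ?I (bmat_mult N (bmat_mult N A C) ?T)) ?J i j"
    by (intro bmat_mult_cong D ij) auto
  also have "\<dots> = bmat_mult N (bmat_mult N ?I A) (bmat_mult N C (bmat_mult N ?T ?J)) i j"
    by (simp only: bmat_mult_assoc)
  also have "\<dots> = C i j"
    using ij bmat_inv_is_inverse[OF A] bmat_inv_is_inverse[OF bmat_invertible_transpose[OF A]]
    by (simp add: bmat_mult_one_left bmat_mult_one_right)
  finally show ?thesis .
qed

text \<open>A row has at most three nonzero blocks. \<open>F\<close> is kept abstract so that the
  sum covers both products with a block column and the action on the vectors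
  \<open>x l\<close>.\<close>

lemma model_row_sum:
  fixes F :: "real^'d^'d \<Rightarrow> nat \<Rightarrow> 'b::comm_monoid_add"
  assumes k: "k \<le> N" and F0: "\<And>l. F 0 l = 0"
  shows "(\<Sum>l\<le>N. F (model_bmat N G k l) l) = F (mat 1) k +
     ((if k \<in> {1..N-1} then F (- G k (k - 1)) (k - 1) else 0) + (if k < N then F (- G k N) N else 0))"
proof -
  have "F (model_bmat N G k l) l = (if l = k then F (mat 1) k else 0) +
     ((if l = k - 1 then if k \<in> {1..N-1} then F (- G k (k - 1)) (k - 1) else 0 else 0) +
      (if l = N then if k < N then F (- G k N) N else 0 else 0))" for l
    using k by (auto simp: model_bmat_def F0)
  then show ?thesis using k by (simp add: sum.distrib)
qed

text \<open>The rows of the inverse, by solving the model equations in the order \<open>N, 0, 1, \<dots>, N - 1\<close>.\<close>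

fun model_inv_rec :: "nat \<Rightarrow> 'd::finite bmat \<Rightarrow> 'd bmat" where
  "model_inv_rec N G 0 l = (if l = 0 then mat 1 else 0) + G 0 N ** (if l = N then mat 1 else 0)"
| "model_inv_rec N G (Suc k) l = (if l = Suc k then mat 1 else 0) + G (Suc k) k ** model_inv_rec N G k l +
     G (Suc k) N ** (if l = N then mat 1 else 0)"

definition model_inv :: "nat \<Rightarrow> 'd::finite bmat \<Rightarrow> 'd bmat" where
  "model_inv N G k l = (if k = N then if l = N then mat 1 else 0 else model_inv_rec N G k l)"

lemma model_inv_row:
  assumes "k \<le> N"
  shows "model_inv N G k l = (if l = k then mat 1 else 0) +
    (if k \<in> {1..N-1} then G k (k - 1) ** model_inv N G (k - 1) l else 0) + (if k < N then G k N ** model_inv N G N l else 0)"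
  using assms by (cases k) (auto simp: model_inv_def)

lemma matrix_mult_uminus_left: "(- A) ** B = - (A ** (B :: real^'n^'m))"
  by (simp add: matrix_matrix_mult_def vec_eq_iff sum_negf)

text \<open>\<open>model_inv_row\<close> is the row equation of a right inverse. For the left
  inverse, the product \<open>?H\<close> satisfies the same recursion driven by the rows of the
  model matrix. The identity satisfies it too, and the recursion determines row \<open>N\<close>
  first and then the rows from 0 upwards.\<close>

lemma bmat_invertible_model: "bmat_invertible N (model_bmat N G)"
proof -
  have row: "bmat_mult N (model_bmat N G) Y k j = Y k j -
      (if k \<in> {1..N-1} then G k (k - 1) ** Y (k - 1) j else 0) - (if k < N then G k N ** Y N j else 0)"
    if "k \<le> N" for k j Y
    unfolding bmat_mult_def
    by (subst model_row_sum[OF that, of "\<lambda>A l. A ** Y l j"]) (simp_all add: matrix_mult_uminus_left)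
  have 1: "bmat_is_one N (bmat_mult N (model_bmat N G) (model_inv N G))"
    unfolding bmat_is_one_def using model_inv_row[of _ N G] by (simp add: row)
  let ?H = "bmat_mult N (model_inv N G) (model_bmat N G)"
  have Hrow: "?H k j = model_bmat N G k j +
      (if k \<in> {1..N-1} then G k (k - 1) ** ?H (k - 1) j else 0) + (if k < N then G k N ** ?H N j else 0)"
    if "k \<le> N" for k j
  proof -
    have "?H k j = (\<Sum>l\<le>N. (if l = k then model_bmat N G l j else 0) +
      (if k \<in> {1..N-1} then G k (k - 1) ** (model_inv N G (k - 1) l ** model_bmat N G l j) else 0) +
      (if k < N then G k N ** (model_inv N G N l ** model_bmat N G l j) else 0))"
      unfolding bmat_mult_def model_inv_row[OF that]
      by (intro sum.cong refl) (simp add: matrix_mult_add_left matrix_mul_assoc)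
    then show ?thesis
      using that by (simp add: sum.distrib bmat_mult_def matrix_mult_sum_right)
  qed
  have HN: "?H N j = (if j = N then mat 1 else 0)" for j
    using Hrow[of N j] by (auto simp: model_bmat_def)
  have "?H k j = (if j = k then mat 1 else 0)" if "k \<le> N" for k j
    using that
  proof (induction k)
    case 0
    show ?case using Hrow[of 0 j] HN[of j] by (auto simp: model_bmat_def)
  next
    case (Suc k)
    then have IH: "?H k j = (if j = k then mat 1 else 0)" by simp
    show ?case
    proof (cases "Suc k = N")
      case False
      then show ?thesis using Suc.prems Hrow[of "Suc k" j] HN[of j] IH by (auto simp: model_bmat_def)
    qed (use HN in auto)
  qed
  then have "bmat_is_one N ?H" by (auto simp: bmat_is_one_def)
  with 1 show ?thesis unfolding bmat_invertible_def by blast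
qed

section \<open>The dynamic model\<close>

context gaussian_family
begin

text \<open>The noise that the model equations force once the coefficients are fixed; whether it is
  white is a separate question.\<close>

definition innovation :: "(nat \<Rightarrow> nat \<Rightarrow> real^'d^'d) \<Rightarrow> nat \<Rightarrow> 'a \<Rightarrow> real^'d" where
  "innovation G k = (\<lambda>\<omega>. \<Sum>l\<le>N. model_bmat N G k l *v x l \<omega>)"

lemma gvec_innovation: "innovation G k \<in> gvec"
  unfolding innovation_def by (intro gvec_intros) simp

lemma innovation_eq:
  assumes "k \<le> N"
  shows "innovation G k \<omega> = x k \<omega> - (if k \<in> {1..N-1} then G k (k - 1) *v x (k - 1) \<omega> else 0) -
     (if k < N then G k N *v x N \<omega> else 0)"
  unfolding innovation_def
  by (subst model_row_sum[OF assms, of "\<lambda>A l. A *v x l \<omega>"]) (simp_all add: matrix_vector_mult_uminus_left)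

text \<open>The guard \<open>0 < N\<close> is there because for \<open>N = 0\<close> block row 0 is
  also the last one and contains only the identity, so \<open>G 0 0\<close> does not occur in
  it.\<close>

lemma model_equations:
  shows "innovation G N \<omega> = x N \<omega>"
    and "0 < N \<Longrightarrow> x 0 \<omega> = G 0 N *v x N \<omega> + innovation G 0 \<omega>"
    and "k \<in> {1..N-1} \<Longrightarrow> x k \<omega> = G k (k-1) *v x (k-1) \<omega> + G k N *v x N \<omega> + innovation G k \<omega>"
  by (auto simp: innovation_eq)

lemma innovation_last: "innovation G N = x N"
  by (simp add: fun_eq_iff model_equations(1))

lemma cross_cov_innovation:
  "cross_cov M (innovation G i) (innovation G j) =
     bmat_mult N (bmat_mult N (model_bmat N G) (\<lambda>i j. cross_cov M (x i) (x j))) (bmat_transpose (model_bmat N G)) i j"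
proof -
  have "cross_cov M (innovation G i) (innovation G j) = (\<Sum>m\<le>N. cross_cov M (innovation G i) (x m) ** transpose (model_bmat N G j m))"
    unfolding innovation_def[of G j]
    by (subst cross_cov_sum_right) (auto intro!: sum.cong gvec_intros gvec_innovation cross_cov_mult_right)
  moreover have "cross_cov M (innovation G i) (x m) = (\<Sum>l\<le>N. model_bmat N G i l ** cross_cov M (x l) (x m))" if "m \<le> N" for m
    unfolding innovation_def[of G i] using that
    by (subst cross_cov_sum_left) (auto intro!: sum.cong gvec_intros cross_cov_mult_left)
  ultimately show ?thesis by (simp add: bmat_mult_def bmat_transpose_def)
qed

lemma model_cov_eq:
  assumes "\<And>i j. i \<le> N \<Longrightarrow> j \<le> N \<Longrightarrow> bmat_diag D i j = cross_cov M (innovation G i) (innovation G j)"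
    and "i \<le> N" "j \<le> N"
  shows "model_cov N G D i j = cross_cov M (x i) (x j)"
  unfolding model_cov_def
  using assms by (intro bmat_congruence_cancel[OF bmat_invertible_model]) (simp_all add: cross_cov_innovation)

text \<open>The model equations give, by induction, that \<open>x i\<close> is a linear combination
  of \<open>x N\<close> and the innovations up to \<open>i\<close>. Conversely the innovation at
  \<open>j\<close> is a combination of \<open>x j\<close>, \<open>x (j - 1)\<close> and
  \<open>x N\<close>. The order of the two indices is exchanged by transposition.\<close>

lemma innovation_white_iff:
  "(\<forall>k\<le>N. \<forall>j\<le>N. k \<noteq> j \<longrightarrow> cross_cov M (innovation G k) (innovation G j) = 0) \<longleftrightarrow>
   (\<forall>k<N. \<forall>i. i < k \<or> i = N \<longrightarrow> cross_cov M (innovation G k) (x i) = 0)" (is "?W \<longleftrightarrow> ?U")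
proof
  assume W: ?W
  have N: "cross_cov M (innovation G k) (x N) = 0" if "k < N" for k
    using W[rule_format, of k N] that by (simp add: innovation_last)
  have "cross_cov M (innovation G k) (x i) = 0" if "i < k" "k < N" for i k
    using that
  proof (induction i)
    case 0
    have "x 0 = (\<lambda>\<omega>. G 0 N *v x N \<omega> + innovation G 0 \<omega>)" using model_equations(2) 0 by auto
    then have "cross_cov M (innovation G k) (x 0) = cross_cov M (innovation G k) (x N) ** transpose (G 0 N) + cross_cov M (innovation G k) (innovation G 0)"
      by (simp add: cross_cov_add_right cross_cov_mult_right gvec_mult gvec_x gvec_innovation)
    then show ?case using N[of k] W 0 by simp
  next
    case (Suc i)
    then have i: "Suc i \<in> {1..N-1}" "i \<le> N" "Suc i \<le> N" by auto
    have "x (Suc i) = (\<lambda>\<omega>. G (Suc i) i *v x i \<omega> + G (Suc i) N *v x N \<omega> + innovation G (Suc i) \<omega>)"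
      using model_equations(3)[OF i(1)] by auto
    then have "cross_cov M (innovation G k) (x (Suc i)) = cross_cov M (innovation G k) (x i) ** transpose (G (Suc i) i) +
        cross_cov M (innovation G k) (x N) ** transpose (G (Suc i) N) + cross_cov M (innovation G k) (innovation G (Suc i))"
      using i by (simp add: cross_cov_add_right cross_cov_mult_right gvec_add gvec_mult gvec_x gvec_innovation)
    then show ?case using N[of k] W Suc i by simp
  qed
  then show ?U using N by blast
next
  assume U: ?U
  have N: "cross_cov M (innovation G k) (innovation G N) = 0" if "k < N" for k
    using U that by (simp add: innovation_last)
  have lt: "cross_cov M (innovation G k) (innovation G j) = 0" if "j < k" "k < N" for j k
  proof -
    have j: "j \<le> N" "j - 1 \<le> N" using that by auto
    show ?thesis
    proof (cases "j = 0")
      case True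
      then have "innovation G j = (\<lambda>\<omega>. x j \<omega> - G j N *v x N \<omega>)"
        using innovation_eq[OF j(1), of G] that by auto
      then show ?thesis
        using U that j by (simp add: cross_cov_diff_right cross_cov_mult_right gvec_mult gvec_x gvec_innovation)
    next
      case False
      then have "innovation G j = (\<lambda>\<omega>. x j \<omega> - G j (j - 1) *v x (j - 1) \<omega> - G j N *v x N \<omega>)"
        using innovation_eq[OF j(1), of G] that by auto
      then show ?thesis
        using U that j False by (simp add: cross_cov_diff_right cross_cov_mult_right gvec_diff gvec_mult gvec_x gvec_innovation)
    qed
  qed
  show ?W
  proof (intro allI impI)
    fix k j assume kj: "k \<le> N" "j \<le> N" "k \<noteq> j"
    consider "j < k" "k < N" | "k < j" "j < N" | "j = N" "k < N" | "k = N" "j < N"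
      using kj by linarith
    then show "cross_cov M (innovation G k) (innovation G j) = 0"
      by cases (simp_all add: lt N cross_cov_eq_0_commute[OF lt] cross_cov_eq_0_commute[OF N])
  qed
qed

section \<open>Both conditional Markov properties in terms of covariances\<close>

lemma CM_L_imp_innovation_uncorrelated:
  assumes "CM_L M N x"
  obtains G where "G 0 0 = 0 \<or> N \<noteq> 0" "\<And>k i. k < N \<Longrightarrow> i < k \<or> i = N \<Longrightarrow> cross_cov M (innovation G k) (x i) = 0"
proof -
  \<comment> \<open>The regressors are those of the model equation; \<open>x 0\<close> has no
    predecessor and is regressed on \<open>x N\<close> alone.\<close>
  define J where "J k = (if k = 0 then {N} else {k - 1, N})" for k
  have J: "J k \<subseteq> {..N}" if "k < N" for k using that by (auto simp: J_def)
  have "\<exists>A. \<forall>j\<in>J k. cross_cov M (residual k (J k) A) (x j) = 0" if "k < N" for k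
    using regression[of k "J k"] J[OF that] that by (metis less_imp_le)
  then obtain A where A: "\<And>k j. k < N \<Longrightarrow> j \<in> J k \<Longrightarrow> cross_cov M (residual k (J k) (A k)) (x j) = 0"
    by metis
  \<comment> \<open>For \<open>N = 0\<close> there is no \<open>k < N\<close> to regress, and zero
    coefficients make the equations for \<open>x 0\<close> and \<open>x N\<close>
    compatible.\<close>
  define G where "G k l = (if N = 0 then 0 else A k l)" for k l
  have res: "innovation G k = residual k (J k) (A k)" if "k < N" for k
    using that by (auto simp: fun_eq_iff innovation_eq residual_def J_def G_def)
  have "cross_cov M (innovation G k) (x i) = 0" if k: "k < N" and i: "i < k \<or> i = N" for k i
  proof (cases "k = 0")
    case True
    then show ?thesis unfolding res[OF k] using A[OF k, of N] i by (simp add: J_def)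
  next
    case False
    have "cross_cov M (residual k (J k) (A k)) (x i) = 0"
    proof (rule cond_CDF_eq_imp_uncorrelated)
      show "AE \<omega> in M. cond_CDF M (x k) x ({0..k - 1} \<union> {N}) \<xi> \<omega> = cond_CDF M (x k) x (J k) \<xi> \<omega>" for \<xi>
        using assms[unfolded CM_L_def, rule_format, of "k - 1" k \<xi>] False k by (simp add: J_def)
      show "cross_cov M (residual k (J k) (A k)) (x j) = 0" if "j \<in> J k" for j
        by (rule A[OF k that])
    qed (use False k i in \<open>auto simp: J_def\<close>)
    then show ?thesis by (simp add: res[OF k])
  qed
  moreover have "G 0 0 = 0 \<or> N \<noteq> 0" by (simp add: G_def)
  ultimately show ?thesis using that by blast
qed

text \<open>Iterating the one-step equations from \<open>j\<close> to \<open>k\<close> predicts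
  \<open>x k\<close> from \<open>x j\<close> and \<open>x N\<close>. The error is a linear
  combination of the innovations after \<open>j\<close>, which are uncorrelated with
  \<open>x N\<close> and with everything up to \<open>j\<close>.\<close>

lemma innovation_uncorrelated_imp_CM_L:
  assumes U: "\<And>k i. k < N \<Longrightarrow> i < k \<or> i = N \<Longrightarrow> cross_cov M (innovation G k) (x i) = 0"
  shows "CM_L M N x"
  unfolding CM_L_def
proof (intro allI impI)
  fix j k \<xi> assume jk: "j < k \<and> k \<le> N"
  have step: "\<exists>A B. \<forall>i. i \<le> j \<or> i = N \<longrightarrow> cross_cov M (\<lambda>\<omega>. x k \<omega> - (A *v x j \<omega> + B *v x N \<omega>)) (x i) = 0"
    if "j \<le> k" "k < N" for k
    using that
  proof (induction rule: dec_induct)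
    case base
    have "(\<lambda>\<omega>. x j \<omega> - (mat 1 *v x j \<omega> + 0 *v x N \<omega>)) = (\<lambda>_. 0)" by simp
    then show ?case
      using base by (intro exI[of _ "mat 1"] exI[of _ 0] allI impI) (auto simp: cross_cov_zero_left gvec_x)
  next
    case (step k)
    then obtain A B where AB: "\<And>i. i \<le> j \<or> i = N \<Longrightarrow> cross_cov M (\<lambda>\<omega>. x k \<omega> - (A *v x j \<omega> + B *v x N \<omega>)) (x i) = 0"
      by auto
    let ?A = "G (Suc k) k ** A" and ?B = "G (Suc k) k ** B + G (Suc k) N"
    have k: "Suc k \<in> {1..N-1}" "k \<le> N" "j \<le> N" using step by auto
    have "(\<lambda>\<omega>. x (Suc k) \<omega> - (?A *v x j \<omega> + ?B *v x N \<omega>)) =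
        (\<lambda>\<omega>. G (Suc k) k *v (x k \<omega> - (A *v x j \<omega> + B *v x N \<omega>)) + innovation G (Suc k) \<omega>)"
      using model_equations(3)[OF k(1), of _ G]
      by (simp add: fun_eq_iff matrix_vector_mult_diff_distrib matrix_vector_right_distrib matrix_vector_mult_add_rdistrib matrix_vector_mul_assoc)
    then have "cross_cov M (\<lambda>\<omega>. x (Suc k) \<omega> - (?A *v x j \<omega> + ?B *v x N \<omega>)) (x i) = 0" if "i \<le> j \<or> i = N" for i
    proof -
      have i: "i \<le> N" "i < Suc k \<or> i = N" using that step by auto
      have "(\<lambda>\<omega>. x k \<omega> - (A *v x j \<omega> + B *v x N \<omega>)) \<in> gvec"
        using k by (intro gvec_intros) auto
      then show ?thesis
        using AB[OF that] U[of "Suc k" i] i step.prems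
        unfolding \<open>(\<lambda>\<omega>. x (Suc k) \<omega> - (?A *v x j \<omega> + ?B *v x N \<omega>)) = _\<close>
        by (simp add: cross_cov_add_left cross_cov_mult_left gvec_mult gvec_innovation gvec_x)
    qed
    then show ?case by blast
  qed
  have "\<exists>A. \<forall>i\<in>{0..j} \<union> {N}. cross_cov M (residual k {j, N} A) (x i) = 0"
  proof (cases "k = N")
    case True
    \<comment> \<open>The endpoint is among the conditioning variables and predicts itself without
      error.\<close>
    then have "residual k {j, N} (\<lambda>l. if l = N then mat 1 else 0) = (\<lambda>_. 0)"
      using jk by (simp add: residual_def fun_eq_iff)
    then show ?thesis
      using jk by (intro exI[of _ "\<lambda>l. if l = N then mat 1 else 0"] ballI) (auto simp: cross_cov_zero_left gvec_x)
  next
    case False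
    then obtain A B where AB: "\<And>i. i \<le> j \<or> i = N \<Longrightarrow> cross_cov M (\<lambda>\<omega>. x k \<omega> - (A *v x j \<omega> + B *v x N \<omega>)) (x i) = 0"
      using step[of k] jk by auto
    have "residual k {j, N} (\<lambda>l. if l = N then B else A) = (\<lambda>\<omega>. x k \<omega> - (A *v x j \<omega> + B *v x N \<omega>))"
      using jk by (simp add: residual_def fun_eq_iff)
    then show ?thesis
      using AB by (intro exI[of _ "\<lambda>l. if l = N then B else A"]) auto
  qed
  then obtain A where "\<And>i. i \<in> {0..j} \<union> {N} \<Longrightarrow> cross_cov M (residual k {j, N} A) (x i) = 0" by blast
  then show "AE \<omega> in M. cond_CDF M (x k) x ({0..j} \<union> {N}) \<xi> \<omega> = cond_CDF M (x k) x {j, N} \<xi> \<omega>"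
    using jk by (intro uncorrelated_imp_cond_CDF_eq) auto
qed

text \<open>With \<open>\<Pi>\<close> the joint covariance of \<open>x j\<close> and \<open>x l\<close>, the two outer factors are \<open>K ** \<Pi>\<close> and
  \<open>\<Pi> ** L\<close> for regression coefficients \<open>K\<close>, \<open>L\<close>, and \<open>\<Pi> ** pinv \<Pi> ** \<Pi> = \<Pi>\<close>.\<close>

lemma pinv_prediction_cov:
  assumes N: "i \<le> N" "j \<le> N" "k \<le> N" "l \<le> N" and jl: "j \<noteq> l"
    and unc: "cross_cov M (residual k {j, l} A) (x j) = 0" "cross_cov M (residual k {j, l} A) (x l) = 0"
  defines "P \<equiv> \<lambda>i j. cross_cov M (x i) (x j)"
  shows "hblock (P k j) (P k l) ** pinv (vblock (hblock (P j j) (P j l)) (hblock (P l j) (P l l))) ** vblock (P j i) (P l i) =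
    P k i - cross_cov M (residual k {j, l} A) (x i)"
proof -
  have res: "cross_cov M (residual k {j, l} B) (x m) = P k m - (B j ** P j m + B l ** P l m)"
    if "k \<le> N" "m \<le> N" for k m B
    using that N jl
    by (simp add: residual_def P_def cross_cov_diff_left cross_cov_add_left cross_cov_mult_left gvec_add gvec_mult gvec_x)
  have tr: "transpose (P a b) = P b a" for a b by (simp add: P_def cross_cov_transpose)
  let ?Pi = "vblock (hblock (P j j) (P j l)) (hblock (P l j) (P l l))"
  let ?K = "hblock (A j) (A l)"
  have K: "hblock (P k j) (P k l) = ?K ** ?Pi"
    using unc N by (simp add: hblock_mult_vblock mult_hblock hblock_add res)
  \<comment> \<open>Regressing \<open>x i\<close> on the same pair factors the right-hand column
    through \<open>?Pi\<close>, as the given coefficients \<open>A\<close> do for the left-hand row.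
    This works for singular \<open>?Pi\<close> as well.\<close>
  obtain B where B: "cross_cov M (residual i {j, l} B) (x j) = 0" "cross_cov M (residual i {j, l} B) (x l) = 0"
    using regression[of i "{j, l}"] N by (metis atMost_iff empty_subsetI insertI1 insert_commute insert_subset)
  have eqB: "P i j = B j ** P j j + B l ** P l j" "P i l = B j ** P j l + B l ** P l l"
    using B N by (simp_all add: res)
  let ?L = "vblock (transpose (B j)) (transpose (B l))"
  have L: "vblock (P j i) (P l i) = ?Pi ** ?L"
    using eqB[THEN arg_cong[where f=transpose]]
    by (simp add: vblock_mult hblock_mult_vblock tr matrix_transpose_mul transpose_def[symmetric] transpose_add)
  have "hblock (P k j) (P k l) ** pinv ?Pi ** vblock (P j i) (P l i) = ?K ** (?Pi ** pinv ?Pi ** ?Pi) ** ?L"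
    unfolding K L by (simp only: matrix_mul_assoc)
  also have "\<dots> = ?K ** vblock (P j i) (P l i)"
    by (simp only: mult_pinv_mult L matrix_mul_assoc)
  also have "\<dots> = P k i - cross_cov M (residual k {j, l} A) (x i)"
    using N by (simp add: hblock_mult_vblock res)
  finally show ?thesis .
qed

text \<open>By \<open>pinv_prediction_cov\<close> the block identity says exactly that the residual
  of \<open>x k\<close> on \<open>x j\<close> and \<open>x k1\<close> is uncorrelated with
  \<open>x i\<close>. For \<open>i = j\<close> and \<open>i = k1\<close> this holds by the choice of
  the coefficients, and for \<open>j = k1\<close> the two conditioning sets coincide; hence the
  restriction to indices above \<open>k1\<close> with \<open>i < j < k\<close>.\<close>

lemma CM_F_iff:
  assumes "k1 \<le> N"
  defines "P \<equiv> \<lambda>i j. cross_cov M (x i) (x j)"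
  shows "CM_F M k1 N x \<longleftrightarrow> (\<forall>i\<in>{k1+1..N}. \<forall>j\<in>{k1+1..N}. \<forall>k\<in>{k1+1..N}. i < j \<and> j < k \<longrightarrow>
           P k i = hblock (P k j) (P k k1)
                   ** pinv (vblock (hblock (P j j) (P j k1)) (hblock (P k1 j) (P k1 k1)))
                   ** vblock (P j i) (P k1 i))" (is "_ \<longleftrightarrow> ?R")
proof -
  have A: "\<exists>A. cross_cov M (residual k {j, k1} A) (x j) = 0 \<and> cross_cov M (residual k {j, k1} A) (x k1) = 0"
    if "j \<le> N" "k \<le> N" for j k
    using regression[of k "{j, k1}"] assms(1) that by (metis atMost_iff empty_subsetI insertI1 insert_commute insert_subset)
  have pinv: "hblock (P k j) (P k k1) ** pinv (vblock (hblock (P j j) (P j k1)) (hblock (P k1 j) (P k1 k1))) ** vblock (P j i) (P k1 i) =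
      P k i - cross_cov M (residual k {j, k1} A) (x i)"
    if "k \<in> {k1+1..N}" "i < j \<and> j < k" "cross_cov M (residual k {j, k1} A) (x j) = 0" "cross_cov M (residual k {j, k1} A) (x k1) = 0" "i \<in> {k1+1..N}"
    for i j k A
    unfolding P_def using that assms(1) by (intro pinv_prediction_cov) auto
  show ?thesis
  proof
    assume F: "CM_F M k1 N x"
    show ?R
    proof (intro ballI impI)
      fix i j k assume ijk: "i \<in> {k1+1..N}" "j \<in> {k1+1..N}" "k \<in> {k1+1..N}" "i < j \<and> j < k"
      then obtain A where A: "cross_cov M (residual k {j, k1} A) (x j) = 0" "cross_cov M (residual k {j, k1} A) (x k1) = 0"
        using A[of j k] by auto
      have "cross_cov M (residual k {j, k1} A) (x i) = 0"
        by (rule cond_CDF_eq_imp_uncorrelated[where I="{k1..j} \<union> {k1}"])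
          (use F[unfolded CM_F_def] A ijk in auto)
      then show "P k i = hblock (P k j) (P k k1) ** pinv (vblock (hblock (P j j) (P j k1)) (hblock (P k1 j) (P k1 k1))) ** vblock (P j i) (P k1 i)"
        using pinv[OF _ _ A, of i] ijk by simp
    qed
  next
    assume R: ?R
    show "CM_F M k1 N x"
      unfolding CM_F_def
    proof (intro allI impI)
      fix j k \<xi> assume jk: "k1 \<le> j \<and> j < k \<and> k \<le> N"
      show "AE \<omega> in M. cond_CDF M (x k) x ({k1..j} \<union> {k1}) \<xi> \<omega> = cond_CDF M (x k) x {j, k1} \<xi> \<omega>"
      proof (cases "j = k1")
        case False
        obtain A where A: "cross_cov M (residual k {j, k1} A) (x j) = 0" "cross_cov M (residual k {j, k1} A) (x k1) = 0"
          using A[of j k] jk by auto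
        have "cross_cov M (residual k {j, k1} A) (x i) = 0" if i: "i \<in> {k1..j} \<union> {k1}" for i
        proof (cases "i = k1 \<or> i = j")
          case False
          then have "i \<in> {k1+1..N}" "j \<in> {k1+1..N}" "k \<in> {k1+1..N}" "i < j \<and> j < k" using i jk by auto
          then have "P k i = P k i - cross_cov M (residual k {j, k1} A) (x i)"
            using pinv[OF _ _ A, of i] R by (metis)
          then show ?thesis by simp
        qed (use A in auto)
        then show ?thesis using jk by (intro uncorrelated_imp_cond_CDF_eq) auto
      qed simp
    qed
  qed
qed

section \<open>The innovations as model noise, and the equivalence\<close>

lemma gspan_inner: "r \<in> gvec \<Longrightarrow> (\<lambda>\<omega>. a \<bullet> r \<omega>) \<in> gspan"
  by (simp add: inner_vec_def gspan_sum gspan_scale gvecD)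

lemma innovation_gaussian: "gaussian_seq M N (innovation G)"
  unfolding gaussian_seq_def
  by (intro conjI allI impI gvec_measurable gvec_innovation gspan_gaussian gspan_sum gspan_inner)

lemma innovation_zero_mean: "zero_mean_seq M N (innovation G)"
  by (simp add: zero_mean_seq_def gvec_mean gvec_innovation)

end

text \<open>The model equations hold almost surely, so a given noise \<open>e\<close> agrees with
  the innovation only up to null sets; this transfers the covariances.\<close>

lemma cross_cov_cong_AE:
  fixes r r' :: "'a \<Rightarrow> real^'m" and s s' :: "'a \<Rightarrow> real^'n"
  assumes meas: "r \<in> borel_measurable M" "r' \<in> borel_measurable M" "s \<in> borel_measurable M" "s' \<in> borel_measurable M"
    and ae: "AE \<omega> in M. r \<omega> = r' \<omega>" "AE \<omega> in M. s \<omega> = s' \<omega>"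
  shows "cross_cov M r s = cross_cov M r' s'"
proof -
  have eq: "(\<integral>\<omega>. r \<omega> \<partial>M) = (\<integral>\<omega>. r' \<omega> \<partial>M)" "(\<integral>\<omega>. s \<omega> \<partial>M) = (\<integral>\<omega>. s' \<omega> \<partial>M)"
    using meas ae by (auto intro: integral_cong_AE)
  have [measurable]: "(\<lambda>\<omega>. r \<omega> $ a) \<in> borel_measurable M" "(\<lambda>\<omega>. r' \<omega> $ a) \<in> borel_measurable M"
     "(\<lambda>\<omega>. s \<omega> $ b) \<in> borel_measurable M" "(\<lambda>\<omega>. s' \<omega> $ b) \<in> borel_measurable M" for a b
    using meas unfolding borel_measurable_vec_iff by auto
  have "(\<integral>\<omega>. (r \<omega> $ a - c) * (s \<omega> $ b - d) \<partial>M) = (\<integral>\<omega>. (r' \<omega> $ a - c) * (s' \<omega> $ b - d) \<partial>M)" for a b c d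
    by (rule integral_cong_AE) (use ae in auto)
  then show ?thesis by (simp add: cross_cov_def eq)
qed

theorem corollary5p1:
  fixes M :: "'a measure" and N k1 :: nat and x :: "nat \<Rightarrow> 'a \<Rightarrow> real^'d"
  assumes "prob_space M"
    and "k1 \<le> N"
    and "gaussian_seq M N x"
    and "zero_mean_seq M N x"
  shows "CM_L M N x \<and> CM_F M k1 N x \<longleftrightarrow>
    (\<exists>(G :: nat \<Rightarrow> nat \<Rightarrow> real^'d^'d) (e :: nat \<Rightarrow> 'a \<Rightarrow> real^'d).
       white_gaussian_seq M N e \<and> zero_mean_seq M N e \<and>
       (\<forall>k\<in>{1..N-1}. AE \<omega> in M. x k \<omega> = G k (k-1) *v x (k-1) \<omega> + G k N *v x N \<omega> + e k \<omega>) \<and>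
       (AE \<omega> in M. x N \<omega> = e N \<omega>) \<and>
       (AE \<omega> in M. x 0 \<omega> = G 0 N *v x N \<omega> + e 0 \<omega>) \<and>
       (let P = model_cov N G (\<lambda>k. Cov M (e k)) in
         \<forall>i\<in>{k1+1..N}. \<forall>j\<in>{k1+1..N}. \<forall>k\<in>{k1+1..N}. i < j \<and> j < k \<longrightarrow>
           P k i = hblock (P k j) (P k k1)
                   ** pinv (vblock (hblock (P j j) (P j k1)) (hblock (P k1 j) (P k1 k1)))
                   ** vblock (P j i) (P k1 i)))" (is "?L \<longleftrightarrow> ?R")
proof -
  interpret gaussian_family M N x
    using assms by (simp add: gaussian_family_def gaussian_family_axioms_def)
  \<comment> \<open>The block identity as a property of a matrix family, so that it can be moved
    between the model covariance and the covariance of \<open>x\<close>, which agree at indices up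
    to \<open>N\<close>.\<close>
  define Q where "Q P \<longleftrightarrow> (\<forall>i\<in>{k1+1..N}. \<forall>j\<in>{k1+1..N}. \<forall>k\<in>{k1+1..N}. i < j \<and> j < k \<longrightarrow>
           P k i = hblock (P k j) (P k k1)
                   ** pinv (vblock (hblock (P j j) (P j k1)) (hblock (P k1 j) (P k1 k1)))
                   ** vblock (P j i) (P k1 i))" for P :: "'d bmat"
  have F: "CM_F M k1 N x \<longleftrightarrow> Q (\<lambda>i j. cross_cov M (x i) (x j))"
    unfolding Q_def by (rule CM_F_iff[OF assms(2)])
  have Qcong: "Q P \<longleftrightarrow> Q P'" if "\<And>i j. i \<le> N \<Longrightarrow> j \<le> N \<Longrightarrow> P i j = P' i j" for P P'
    unfolding Q_def using assms(2) that by (intro ball_cong refl) simp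
  \<comment> \<open>Whiteness makes the noise covariance block diagonal, so the diagonal family of
    the \<open>Cov M (e k)\<close> is the full covariance of the innovations.\<close>
  have cov: "model_cov N G (\<lambda>k. Cov M (e k)) i j = cross_cov M (x i) (x j)"
    if e: "\<And>i j. i \<le> N \<Longrightarrow> j \<le> N \<Longrightarrow> cross_cov M (e i) (e j) = cross_cov M (innovation G i) (innovation G j)"
      and white: "\<forall>k\<le>N. \<forall>j\<le>N. k \<noteq> j \<longrightarrow> cross_cov M (e k) (e j) = 0" and ij: "i \<le> N" "j \<le> N" for G e i j
    by (rule model_cov_eq) (use e white ij in \<open>auto simp: bmat_diag_def\<close>)
  show ?thesis
  proof
    assume L: ?L
    then obtain G where G0: "G 0 0 = 0 \<or> N \<noteq> 0"
      and U: "\<And>k i. k < N \<Longrightarrow> i < k \<or> i = N \<Longrightarrow> cross_cov M (innovation G k) (x i) = 0"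
      using CM_L_imp_innovation_uncorrelated by blast
    have W: "\<forall>k\<le>N. \<forall>j\<le>N. k \<noteq> j \<longrightarrow> cross_cov M (innovation G k) (innovation G j) = 0"
      using U innovation_white_iff by blast
    have "Q (model_cov N G (\<lambda>k. Cov M (innovation G k)))"
    proof -
      have "Q (model_cov N G (\<lambda>k. Cov M (innovation G k))) \<longleftrightarrow> Q (\<lambda>i j. cross_cov M (x i) (x j))"
        by (rule Qcong) (rule cov[OF refl W])
      then show ?thesis using F L by blast
    qed
    \<comment> \<open>For \<open>N = 0\<close> the equation reads
      \<open>x 0 = G 0 0 *v x 0 + x 0\<close>, which holds because \<open>G 0 0 = 0\<close>.\<close>
    moreover have "x 0 \<omega> = G 0 N *v x N \<omega> + innovation G 0 \<omega>" for \<omega>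
      using model_equations(1)[of G \<omega>] model_equations(2)[of \<omega> G] G0 by (cases "N = 0") auto
    ultimately show ?R
      using W innovation_gaussian innovation_zero_mean model_equations(1)[of G] model_equations(3)[of _ _ G]
      by (intro exI[of _ G] exI[of _ "innovation G"]) (simp add: white_gaussian_seq_def Q_def Let_def)
  next
    assume ?R
    then obtain G e where white: "white_gaussian_seq M N e"
      and eqk: "\<forall>k\<in>{1..N-1}. AE \<omega> in M. x k \<omega> = G k (k-1) *v x (k-1) \<omega> + G k N *v x N \<omega> + e k \<omega>"
      and eqN: "AE \<omega> in M. x N \<omega> = e N \<omega>" and eq0: "AE \<omega> in M. x 0 \<omega> = G 0 N *v x N \<omega> + e 0 \<omega>"
      and Q: "Q (model_cov N G (\<lambda>k. Cov M (e k)))"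
      unfolding Q_def Let_def by blast
    have meas: "e k \<in> borel_measurable M" if "k \<le> N" for k
      using white that by (simp add: white_gaussian_seq_def gaussian_seq_def)
    \<comment> \<open>Each model equation can be solved for its noise term. For \<open>N = 0\<close>
      the equation for \<open>x N\<close> is the one used.\<close>
    have "AE \<omega> in M. e k \<omega> = innovation G k \<omega>" if kN: "k \<le> N" for k
    proof -
      consider "k = N" | "k = 0" "0 < N" | "k \<in> {1..N-1}" using kN by (cases "k = N"; cases "k = 0") auto
      then show ?thesis
      proof cases
        case 1
        from eqN show ?thesis by eventually_elim (simp add: 1 innovation_last)
      next
        case 2
        from eq0 show ?thesis
          by eventually_elim (use 2 model_equations(2)[of _ G] in \<open>metis add_left_cancel\<close>)
      next
        case 3
        from bspec[OF eqk 3] show ?thesis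
          by eventually_elim (use model_equations(3)[OF 3, of _ G] in \<open>metis add_left_cancel\<close>)
      qed
    qed
    then have e: "cross_cov M (e i) (e j) = cross_cov M (innovation G i) (innovation G j)" if "i \<le> N" "j \<le> N" for i j
      using that by (intro cross_cov_cong_AE meas gvec_measurable gvec_innovation)
    have W: "\<forall>k\<le>N. \<forall>j\<le>N. k \<noteq> j \<longrightarrow> cross_cov M (e k) (e j) = 0"
      using white by (simp add: white_gaussian_seq_def)
    then have "\<forall>k<N. \<forall>i. i < k \<or> i = N \<longrightarrow> cross_cov M (innovation G k) (x i) = 0"
      using e innovation_white_iff[of G] by simp
    then have "CM_L M N x" by (intro innovation_uncorrelated_imp_CM_L) blast
    moreover have "CM_F M k1 N x"
    proof -
      have "Q (model_cov N G (\<lambda>k. Cov M (e k))) \<longleftrightarrow> Q (\<lambda>i j. cross_cov M (x i) (x j))"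
        by (rule Qcong) (rule cov[OF e W])
      then show ?thesis using F Q by blast
    qed
    ultimately show ?L ..
  qed
qed

end
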